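(* Let $a=\{a_n\}_{n\ge1}$ and $b=\{b_n\}_{n\ge 1}$ be non-increasing, summable sequences of positive real numbers, with associated Cantor sets $C_a$ and $C_b$. The following are equivalent: (1) the dimension function associated to $a$ is equivalent to the dimension function associated to $b$, i.e. $h_a\equiv h_b$, where $h_a$ and $h_b$ are functions associated to $a$ and $b$ respectively; (2) $C_a$ and $C_b$ are $h$-regular for precisely the same set of dimension functions $h\in\mathcal{D}$; (3) the dimension partitions of $C_a$ and $C_b$ coincide, i.e. $\mathcal{H}_\alpha^{C_a}\cap\mathcal{P}_\beta^{C_a}=\mathcal{H}_\alpha^{C_b}\cap\mathcal{P}_\beta^{C_b}$ for all $\alpha\le\beta$ in $\{0,1,\infty\}$; (4) the sequence $a$ is weak tail-equivalent to the sequence $b$.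
   Context: Dimension functions: a function $h$ on an interval $(0,A]$ is increasing if $h(x)<h(y)$ whenever $x<y$, and doubling if there is $\tau>0$ with $h(x)\ge\tau h(2x)$ for all $x$ with $x,2x$ in the domain. A dimension function is a continuous, increasing, doubling function $h:(0,A]\to(0,\infty)$ (for some $A>0$, which may depend on $h$) with $h(x)\to0$ as $x\to0^+$; put $h(0)=0$. $\mathcal{D}$ is the set of dimension functions. Measures: for $E\subseteq\mathbb{R}$, with $|B|$ the diameter of $B$, $H^h(E)=\lim_{\delta\to0^+}\inf\{\sum_i h(|E_i|): E\subseteq\bigcup_i E_i,\ |E_i|\le\delta\}$ (countable covers). A $\delta$-packing of $E$ is a disjoint family of open balls (open intervals) centered at points of $E$ with diameters less than $\delta$. The $h$-packing pre-measure is $P_0^h(E)=\lim_{\delta\to0^+}\sup\{\sum_i h(|B_i|):\{B_i\}\text{ a }\delta\text{-packing of }E\}$, and the $h$-packing measure is $P^h(E)=\inf\{\sum_{i=1}^\infty P_0^h(E_i): E=\bigcup_{i=1}^\infty E_i\}$. $E$ is $h$-regular if $0<H^h(E)\le P^h(E)<\infty$. Dimension partition: $\mathcal{H}_\alpha^E=\{h\in\mathcal{D}:H^h(E)=\alpha\}$ for $\alpha=0,\infty$ and $\mathcal{H}_1^E=\{h\in\mathcal{D}:0<H^h(E)<\infty\}$; $\mathcal{P}_\beta^E$ is defined in the same way with $P^h$ in place of $H^h$. The dimension partition of $E$ is the family of the sets $\mathcal{H}_\alpha^E\cap\mathcal{P}_\beta^E$, $\alpha\le\beta\in\{0,1,\infty\}$.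 Equivalence: $f\preceq h$ means there is $c>0$ with $f(x)\le c\,h(x)$ for all $x$ (in the common domain); $f\equiv h$ means $f\preceq h$ and $h\preceq f$. Positive sequences $x,y$ are equivalent if there are $c_1,c_2>0$ with $c_1\le x_n/y_n\le c_2$ for all $n$. The Cantor set $C_a$: for a positive, non-increasing, summable $a$, set $\ell_n=\sum_{k\ge0}\sum_{j=0}^{2^k-1}a_{2^kn+j}$, so $\ell_1=\sum_n a_n$ and $\ell_n=a_n+\ell_{2n}+\ell_{2n+1}$. Let $I_1$ be a closed interval of length $\ell_1$; given the closed interval $I_n$ of length $\ell_n$, remove from it an open interval of length $a_n$ so that the remaining left closed interval $I_{2n}$ has length $\ell_{2n}$ and the remaining right closed interval $I_{2n+1}$ has length $\ell_{2n+1}$. Then $C_a=\bigcap_{k\ge0}\bigcup_{n=2^k}^{2^{k+1}-1}I_n$. The tails are $r_n^{(a)}=\sum_{j\ge n}a_j$. Associated functions: an increasing continuous $h:(0,A]\to(0,\infty)$ is associated to $a$ if the sequence $\{h(r_n^{(a)}/n)\}$ (over those $n$ with $r_n^{(a)}/n\le A$) is equivalent to $\{1/n\}$. Every function associated to $a$ is a dimension function, and any two are equivalent, so one speaks of "the" associated dimension function $h_a$. Weak tail-equivalence: $a$ and $b$ are weak tail-equivalent if there are positive integers $j,k$ such that $r_n^{(a)}\ge r_{jn}^{(b)}/j$ and $r_n^{(b)}\ge r_{kn}^{(a)}/k$ for all $n\ge1$. *)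

theory Defs
  imports "HOL-Analysis.Analysis"
begin

text \<open>
  A function \<open>h : (0,A] \<rightarrow> (0,\<infinity>)\<close> is represented by the pair \<open>(A, h)\<close>, where \<open>h\<close> is extended by
  \<open>0\<close> outside \<open>(0,A]\<close>. This makes the representation unique and builds in the convention
  \<open>h 0 = 0\<close>.
\<close>

type_synonym pfun = "real \<times> (real \<Rightarrow> real)"

definition inc_cont_fun :: "pfun \<Rightarrow> bool" where
  "inc_cont_fun = (\<lambda>(A, h). 0 < A \<and> continuous_on {0<..A} h \<and> strict_mono_on {0<..A} h \<and>
     (\<forall>x\<in>{0<..A}. 0 < h x) \<and> (\<forall>x. x \<notin> {0<..A} \<longrightarrow> h x = 0))"

definition doubling :: "pfun \<Rightarrow> bool" where
  "doubling = (\<lambda>(A, h). \<exists>\<tau>>0. \<forall>x. x \<in> {0<..A} \<and> 2 * x \<in> {0<..A} \<longrightarrow> h x \<ge> \<tau> * h (2 * x))"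

definition dimension_functions :: "pfun set" where
  "dimension_functions =
     {(A, h). inc_cont_fun (A, h) \<and> doubling (A, h) \<and> (h \<longlongrightarrow> 0) (at_right 0)}"

definition dominated :: "pfun \<Rightarrow> pfun \<Rightarrow> bool" where
  "dominated = (\<lambda>(A, f) (B, h). \<exists>c>0. \<forall>x\<in>{0<..A} \<inter> {0<..B}. f x \<le> c * h x)"

definition equivalent_fun :: "pfun \<Rightarrow> pfun \<Rightarrow> bool" where
  "equivalent_fun f h \<longleftrightarrow> dominated f h \<and> dominated h f"

text \<open>
  Only the values of \<open>h\<close> near \<open>0\<close> enter the limits \<open>\<delta> \<rightarrow> 0+\<close> below, so the measures are defined
  for the extended function alone. Boundedness of the covering sets has to be required because
  \<^const>\<open>diameter\<close> is not meaningful on unbounded sets.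
\<close>

definition hausdorff_pre :: "(real \<Rightarrow> real) \<Rightarrow> real \<Rightarrow> real set \<Rightarrow> ennreal" where
  "hausdorff_pre h \<delta> E =
     (INF F \<in> {F :: nat \<Rightarrow> real set. E \<subseteq> (\<Union>i. F i) \<and> (\<forall>i. bounded (F i) \<and> diameter (F i) \<le> \<delta>)}.
        \<Sum>i. ennreal (h (diameter (F i))))"

definition hausdorff_measure :: "(real \<Rightarrow> real) \<Rightarrow> real set \<Rightarrow> ennreal" where
  "hausdorff_measure h E = Lim (at_right 0) (\<lambda>\<delta>. hausdorff_pre h \<delta> E)"

definition is_packing :: "real \<Rightarrow> real set \<Rightarrow> real set set \<Rightarrow> bool" where
  "is_packing \<delta> E \<B> \<longleftrightarrow> disjoint \<B> \<and> (\<forall>B\<in>\<B>. \<exists>x\<in>E. \<exists>\<rho>>0. B = ball x \<rho>) \<and> (\<forall>B\<in>\<B>. diameter B < \<delta>)"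

definition packing_premeasure :: "(real \<Rightarrow> real) \<Rightarrow> real set \<Rightarrow> ennreal" where
  "packing_premeasure h E =
     Lim (at_right 0) (\<lambda>\<delta>. SUP \<B> \<in> {\<B>. is_packing \<delta> E \<B>}. \<Sum>\<^sub>\<infinity>B\<in>\<B>. ennreal (h (diameter B)))"

definition packing_measure :: "(real \<Rightarrow> real) \<Rightarrow> real set \<Rightarrow> ennreal" where
  "packing_measure h E =
     (INF F \<in> {F :: nat \<Rightarrow> real set. E = (\<Union>i. F i)}. \<Sum>i. packing_premeasure h (F i))"

definition regular_for :: "(real \<Rightarrow> real) \<Rightarrow> real set \<Rightarrow> bool" where
  "regular_for h E \<longleftrightarrow> 0 < hausdorff_measure h E \<and>
     hausdorff_measure h E \<le> packing_measure h E \<and> packing_measure h E < \<infinity>"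

text \<open>The index \<open>\<alpha>\<close> of the two classes below is meant to range over \<open>{0, 1, \<infinity>}\<close>.\<close>

definition hausdorff_class :: "ennreal \<Rightarrow> real set \<Rightarrow> pfun set" where
  "hausdorff_class \<alpha> E = {(A, h) \<in> dimension_functions.
     if \<alpha> = 1 then 0 < hausdorff_measure h E \<and> hausdorff_measure h E < \<infinity>
     else hausdorff_measure h E = \<alpha>}"

definition packing_class :: "ennreal \<Rightarrow> real set \<Rightarrow> pfun set" where
  "packing_class \<beta> E = {(A, h) \<in> dimension_functions.
     if \<beta> = 1 then 0 < packing_measure h E \<and> packing_measure h E < \<infinity>
     else packing_measure h E = \<beta>}"

text \<open>
  Sequences are indexed by \<open>n \<ge> 1\<close>; the value at \<open>0\<close> is never used.
\<close>

definition gap_sequence :: "(nat \<Rightarrow> real) \<Rightarrow> bool" where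
  "gap_sequence a \<longleftrightarrow> (\<forall>n\<ge>1. 0 < a n) \<and> (\<forall>m n. 1 \<le> m \<and> m \<le> n \<longrightarrow> a n \<le> a m) \<and> summable a"

definition len :: "(nat \<Rightarrow> real) \<Rightarrow> nat \<Rightarrow> real" where
  "len a n = (\<Sum>k. \<Sum>j<2^k. a (2^k * n + j))"

text \<open>
  Left endpoint of \<open>I\<^sub>n\<close>, where \<open>I\<^sub>1\<close> starts at \<open>s\<close>: the interval \<open>I\<^bsub>2n\<^esub>\<close> starts where \<open>I\<^sub>n\<close> does, and
  \<open>I\<^bsub>2n+1\<^esub>\<close> starts after \<open>I\<^bsub>2n\<^esub>\<close> and a gap of length \<open>a\<^sub>n\<close>.
\<close>

fun left_end :: "real \<Rightarrow> (nat \<Rightarrow> real) \<Rightarrow> nat \<Rightarrow> real" where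
  "left_end s a n =
     (if n \<le> 1 then s
      else if even n then left_end s a (n div 2)
      else left_end s a (n div 2) + len a (2 * (n div 2)) + a (n div 2))"

declare left_end.simps [simp del]

definition cantor_interval :: "real \<Rightarrow> (nat \<Rightarrow> real) \<Rightarrow> nat \<Rightarrow> real set" where
  "cantor_interval s a n = {left_end s a n .. left_end s a n + len a n}"

definition cantor_set :: "real \<Rightarrow> (nat \<Rightarrow> real) \<Rightarrow> real set" where
  "cantor_set s a = (\<Inter>k. \<Union>n\<in>{2^k..2^(k+1)-1}. cantor_interval s a n)"

definition tail :: "(nat \<Rightarrow> real) \<Rightarrow> nat \<Rightarrow> real" where
  "tail a n = (\<Sum>j. a (n + j))"

definition equivalent_seq_on :: "nat set \<Rightarrow> (nat \<Rightarrow> real) \<Rightarrow> (nat \<Rightarrow> real) \<Rightarrow> bool" where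
  "equivalent_seq_on N x y \<longleftrightarrow> (\<exists>c\<^sub>1>0. \<exists>c\<^sub>2>0. \<forall>n\<in>N. c\<^sub>1 \<le> x n / y n \<and> x n / y n \<le> c\<^sub>2)"

definition associated :: "(nat \<Rightarrow> real) \<Rightarrow> pfun \<Rightarrow> bool" where
  "associated a = (\<lambda>(A, h). inc_cont_fun (A, h) \<and>
     equivalent_seq_on {n. 1 \<le> n \<and> tail a n / real n \<le> A}
       (\<lambda>n. h (tail a n / real n)) (\<lambda>n. 1 / real n))"

definition weak_tail_equivalent :: "(nat \<Rightarrow> real) \<Rightarrow> (nat \<Rightarrow> real) \<Rightarrow> bool" where
  "weak_tail_equivalent a b \<longleftrightarrow> (\<exists>j k :: nat. 1 \<le> j \<and> 1 \<le> k \<and>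
     (\<forall>n\<ge>1. tail a n \<ge> tail b (j * n) / real j \<and> tail b n \<ge> tail a (k * n) / real k))"

definition all_equivalent :: "bool list \<Rightarrow> bool" where
  "all_equivalent ps \<longleftrightarrow> (\<forall>p\<in>set ps. \<forall>q\<in>set ps. p \<longleftrightarrow> q)"

end

theory Submission
  imports Defs
begin

text \<open>
  Let \<open>s\<^sub>k\<close> be the average length \<open>tail a (2 ^ k) / 2 ^ k\<close> of the \<open>2 ^ k\<close> intervals of level \<open>k\<close>.
  Since the lengths are non-increasing, each interval of level \<open>k\<close> has length between \<open>s\<^bsub>k+1\<^esub>\<close> and
  \<open>s\<^bsub>k-1\<^esub>\<close>. Comparing covers and packings with the intervals of the Cantor set shows that \<open>H\<^sup>h\<close> of the
  Cantor set vanishes or is infinite together with \<open>liminf 2 ^ k * h s\<^sub>k\<close>, and \<open>P\<^sup>h\<close> together with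
  \<open>limsup 2 ^ k * h s\<^sub>k\<close>. All four conditions then say that each of the two sequences of averages
  is dominated by the other up to an index shift: a function associated to \<open>a\<close> keeps
  \<open>2 ^ k * h s\<^sub>k\<close> between two positive constants, so testing the Cantor set of \<open>b\<close> with it compares
  the averages of \<open>b\<close> with those of \<open>a\<close>. Regularity also asks for \<open>H\<^sup>h \<le> P\<^sup>h\<close>; this holds for every
  set and every dimension function, by the Vitali covering lemma.
\<close>

subsection \<open>Hausdorff and packing measures\<close>

text \<open>Two obstacles shape the argument. The packing measure is an infimum over arbitrary
  countable decompositions, so its lower bound has to be shared among the pieces: a piece is
  credited with the infimum over \<open>k\<close> of the proportion of intervals of level
  \<open>k\<close> that it meets. Since each piece may choose its own level, the intervals met form
  a cover of the Cantor set, and the credits sum to at least 1. Moreover, consecutive averages s_k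
  can have arbitrarily large ratios, so diameters are compared by levels and not by constant
  factors. Every comparison loses a bounded number of levels, that is, a constant factor in 2^k
  h(s_k). This is harmless because only the values 0 and infinity are tested; the class
  \<open>1\<close> is what remains.\<close>

lemma Lim_at_right_antimono:
  fixes f :: "real \<Rightarrow> ennreal"
  assumes "\<And>x y. 0 < x \<Longrightarrow> x \<le> y \<Longrightarrow> f y \<le> f x"
  shows "Lim (at_right 0) f = (SUP x\<in>{0<..}. f x)"
proof (rule tendsto_Lim[OF trivial_limit_at_right_real], rule order_tendstoI)
  fix c assume "c < (SUP x\<in>{0<..}. f x)"
  then obtain x where x: "0 < x" "c < f x"
    by (auto simp: less_SUP_iff)
  have "\<forall>\<^sub>F y in at_right 0. y \<in> {0<..<x}"
    using x(1) by (rule eventually_at_right_real)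
  then show "\<forall>\<^sub>F y in at_right 0. c < f y"
    by eventually_elim (use assms x in \<open>auto intro: less_le_trans\<close>)
next
  fix c assume "(SUP x\<in>{0<..}. f x) < c"
  then have "f y < c" if "0 < y" for y
    using that by (meson SUP_lessD greaterThan_iff)
  then show "\<forall>\<^sub>F y in at_right 0. f y < c"
    by (auto simp: eventually_at_right_field intro: exI[of _ 1])
qed

lemma Lim_at_right_mono:
  fixes f :: "real \<Rightarrow> ennreal"
  assumes "\<And>x y. 0 < x \<Longrightarrow> x \<le> y \<Longrightarrow> f x \<le> f y"
  shows "Lim (at_right 0) f = (INF x\<in>{0<..}. f x)"
proof (rule tendsto_Lim[OF trivial_limit_at_right_real], rule order_tendstoI)
  fix c assume "(INF x\<in>{0<..}. f x) < c"
  then obtain x where x: "0 < x" "f x < c"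
    by (auto simp: INF_less_iff)
  have "\<forall>\<^sub>F y in at_right 0. y \<in> {0<..<x}"
    using x(1) by (rule eventually_at_right_real)
  then show "\<forall>\<^sub>F y in at_right 0. f y < c"
    by eventually_elim (use assms[of _ x] x(2) in \<open>fastforce dest: le_less_trans[of _ "f x"]\<close>)
next
  fix c assume "c < (INF x\<in>{0<..}. f x)"
  then have "c < f y" if "0 < y" for y
    using that by (meson less_INF_D greaterThan_iff)
  then show "\<forall>\<^sub>F y in at_right 0. c < f y"
    by (auto simp: eventually_at_right_field intro: exI[of _ 1])
qed

lemma hausdorff_pre_antimono:
  assumes "\<delta> \<le> \<delta>'"
  shows "hausdorff_pre h \<delta>' E \<le> hausdorff_pre h \<delta> E"
  unfolding hausdorff_pre_def by (rule INF_superset_mono) (use assms in \<open>auto intro: order_trans\<close>)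

text \<open>\<open>Lim\<close> is a description operator, so its value is known only once
  convergence is shown. A smaller \<delta> admits fewer covers, and this monotonicity gives the
  limit.\<close>

lemma hausdorff_measure_eq_SUP:
  "hausdorff_measure h E = (SUP \<delta>\<in>{0<..}. hausdorff_pre h \<delta> E)"
  unfolding hausdorff_measure_def by (rule Lim_at_right_antimono) (rule hausdorff_pre_antimono)

lemma hausdorff_pre_le_measure: "0 < \<delta> \<Longrightarrow> hausdorff_pre h \<delta> E \<le> hausdorff_measure h E"
  unfolding hausdorff_measure_eq_SUP by (rule SUP_upper) simp

text \<open>Covers are sequences by definition, whereas those built later are indexed by a level or
  by a disjoint sum. Bounding finite subsums avoids infinite sums over \<open>I\<close>.\<close>

lemma hausdorff_pre_le_countable_cover:
  assumes I: "countable I" "E \<subseteq> (\<Union>i\<in>I. U i)"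
    and U: "\<And>i. i \<in> I \<Longrightarrow> bounded (U i)" "\<And>i. i \<in> I \<Longrightarrow> diameter (U i) \<le> \<delta>"
    and "0 \<le> \<delta>" "h 0 = 0"
    and S: "\<And>J. finite J \<Longrightarrow> J \<subseteq> I \<Longrightarrow> (\<Sum>i\<in>J. ennreal (h (diameter (U i)))) \<le> S"
  shows "hausdorff_pre h \<delta> E \<le> S"
proof -
  define F where "F n = (if n \<in> to_nat_on I ` I then U (from_nat_into I n) else {})" for n
  have F: "F (to_nat_on I i) = U i" if "i \<in> I" for i
    using that I(1) by (auto simp: F_def)
  have "E \<subseteq> (\<Union>n. F n)"
    using I F by blast
  moreover have "bounded (F n) \<and> diameter (F n) \<le> \<delta>" for n
    using U F \<open>0 \<le> \<delta>\<close> by (cases "n \<in> to_nat_on I ` I") (auto simp: F_def)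
  ultimately have "hausdorff_pre h \<delta> E \<le> (\<Sum>n. ennreal (h (diameter (F n))))"
    unfolding hausdorff_pre_def by (intro INF_lower) simp
  also have "\<dots> \<le> S"
  proof (rule suminf_le_const[OF summableI])
    fix N
    define J where "J = {i \<in> I. to_nat_on I i < N}"
    have inj: "inj_on (to_nat_on I) J"
      using inj_on_to_nat_on[OF I(1)] by (rule inj_on_subset) (auto simp: J_def)
    have "finite J"
      by (rule inj_on_finite[OF inj, of "{..<N}"]) (auto simp: J_def)
    have "(\<Sum>n<N. ennreal (h (diameter (F n)))) =
        (\<Sum>n\<in>to_nat_on I ` J. ennreal (h (diameter (F n))))"
      by (rule sum.mono_neutral_right) (auto simp: J_def F_def \<open>h 0 = 0\<close>)
    also have "\<dots> = (\<Sum>i\<in>J. ennreal (h (diameter (U i))))"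
      using inj F by (simp add: sum.reindex J_def)
    also have "\<dots> \<le> S"
      using \<open>finite J\<close> by (rule S) (auto simp: J_def)
    finally show "(\<Sum>n<N. ennreal (h (diameter (F n)))) \<le> S" .
  qed
  finally show ?thesis .
qed

lemma hausdorff_pre_approx:
  assumes "hausdorff_pre h \<delta> E < x"
  obtains F :: "nat \<Rightarrow> real set" where "E \<subseteq> (\<Union>i. F i)" "\<And>i. bounded (F i)"
    "\<And>i. diameter (F i) \<le> \<delta>" "(\<Sum>i. ennreal (h (diameter (F i)))) < x"
  using assms unfolding hausdorff_pre_def INF_less_iff by blast

lemma suminf_half_powers_ennreal: "(\<Sum>i. ennreal (e * (1/2)^Suc i)) = ennreal e" if "0 \<le> e"
proof -
  have "(\<lambda>i. e * (1/2)^Suc i) sums e"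
    using sums_mult[OF power_half_series, of e] by simp
  then show ?thesis
    using that by (intro sums_unique[symmetric]) (subst sums_ennreal; simp)
qed

lemma suminf_add_half_powers_ennreal:
  assumes "0 \<le> e" "\<And>i. 0 \<le> f i"
  shows "(\<Sum>i. ennreal (f i + e * (1/2)^Suc i)) = (\<Sum>i. ennreal (f i)) + ennreal e"
proof -
  have "ennreal (f i + e * (1/2)^Suc i) = ennreal (f i) + ennreal (e * (1/2)^Suc i)" for i
    using assms by (intro ennreal_plus) auto
  then show ?thesis
    using assms(1) by (simp only: suminf_add[OF summableI summableI, symmetric] suminf_half_powers_ennreal)
qed

text \<open>Needed to add up the pieces of a decomposition in the packing measure. Piece
  \<open>i\<close> gets a cover with excess e/2^(i+1), and pairing merges the covers into one
  sequence.\<close>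

lemma hausdorff_measure_UN_le:
  "hausdorff_measure h (\<Union>i::nat. E i) \<le> (\<Sum>i. hausdorff_measure h (E i))"
proof (cases "(\<Sum>i. hausdorff_measure h (E i)) = \<infinity>")
  case False
  have fin: "hausdorff_measure h (E i) \<noteq> \<infinity>" for i
    using False ennreal_suminf_lessD[of "\<lambda>i. hausdorff_measure h (E i)" \<infinity>] by (simp add: less_top)
  have "hausdorff_pre h \<delta> (\<Union>i. E i) \<le> (\<Sum>i. hausdorff_measure h (E i))" if "0 < \<delta>" for \<delta>
  proof (rule ennreal_le_epsilon)
    fix e :: real assume "0 < e"
    define y where "y i = hausdorff_measure h (E i) + ennreal (e * (1/2)^Suc i)" for i
    have "hausdorff_pre h \<delta> (E i) < y i" for i
    proof -
      have "hausdorff_pre h \<delta> (E i) \<le> hausdorff_measure h (E i)"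
        using that by (rule hausdorff_pre_le_measure)
      also have "\<dots> < y i"
        using fin[of i] \<open>0 < e\<close> unfolding y_def
        by (subst add_0_right[symmetric], subst ennreal_add_left_cancel_less) auto
      finally show ?thesis .
    qed
    then have "\<exists>F::nat \<Rightarrow> real set. E i \<subseteq> (\<Union>j. F j) \<and> (\<forall>j. bounded (F j) \<and> diameter (F j) \<le> \<delta>) \<and>
        (\<Sum>j. ennreal (h (diameter (F j)))) < y i" for i
      using hausdorff_pre_approx[of h \<delta> "E i" "y i"] by metis
    then obtain F :: "nat \<Rightarrow> nat \<Rightarrow> real set"
      where F: "\<And>i. E i \<subseteq> (\<Union>j. F i j)" "\<And>i j. bounded (F i j)" "\<And>i j. diameter (F i j) \<le> \<delta>"
        "\<And>i. (\<Sum>j. ennreal (h (diameter (F i j)))) < y i"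
      by metis
    define G where "G n = (case prod_decode n of (i, j) \<Rightarrow> F i j)" for n
    have "(\<Union>i. E i) \<subseteq> (\<Union>n. G n)"
    proof
      fix x assume "x \<in> (\<Union>i. E i)"
      then obtain i j where "x \<in> F i j"
        using F(1) by blast
      then show "x \<in> (\<Union>n. G n)"
        by (auto simp: G_def intro!: exI[of _ "prod_encode (i, j)"])
    qed
    moreover have "bounded (G n) \<and> diameter (G n) \<le> \<delta>" for n
      using F(2,3) by (simp add: G_def split: prod.split)
    ultimately have "hausdorff_pre h \<delta> (\<Union>i. E i) \<le> (\<Sum>n. ennreal (h (diameter (G n))))"
      unfolding hausdorff_pre_def by (intro INF_lower) simp
    also have "\<dots> = (\<Sum>n. (\<lambda>(i, j). ennreal (h (diameter (F i j)))) (prod_decode n))"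
      by (intro suminf_cong) (simp add: G_def split: prod.split)
    also have "\<dots> = (\<Sum>i. \<Sum>j. ennreal (h (diameter (F i j))))"
      by (rule suminf_ennreal_2dimen) simp
    also have "\<dots> \<le> (\<Sum>i. y i)"
      using F(4) by (intro suminf_le) (auto intro: less_imp_le)
    also have "\<dots> = (\<Sum>i. hausdorff_measure h (E i)) + ennreal e"
      using \<open>0 < e\<close> unfolding y_def
      by (simp only: suminf_add[OF summableI summableI, symmetric] suminf_half_powers_ennreal less_imp_le)
    finally show "hausdorff_pre h \<delta> (\<Union>i. E i) \<le> (\<Sum>i. hausdorff_measure h (E i)) + ennreal e" .
  qed
  then show ?thesis
    unfolding hausdorff_measure_eq_SUP[of h "\<Union>i. E i"] by (intro SUP_least) simp
qed simp

section \<open>Packing pre-measures through finite packings\<close>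

definition packing_pre :: "(real \<Rightarrow> real) \<Rightarrow> real \<Rightarrow> real set \<Rightarrow> ennreal" where
  "packing_pre h \<delta> E =
     (SUP \<B> \<in> {\<B>. finite \<B> \<and> is_packing \<delta> E \<B>}. \<Sum>B\<in>\<B>. ennreal (h (diameter B)))"

lemma is_packing_subset: "is_packing \<delta> E \<B> \<Longrightarrow> \<B>' \<subseteq> \<B> \<Longrightarrow> is_packing \<delta> E \<B>'"
  unfolding is_packing_def by (auto intro: pairwise_subset)

text \<open>A sum of nonnegative terms is the supremum of its finite subsums, and a subfamily of a
  packing is a packing.\<close>

lemma packing_pre_eq_SUP_infsum:
  "(SUP \<B> \<in> {\<B>. is_packing \<delta> E \<B>}. \<Sum>\<^sub>\<infinity>B\<in>\<B>. ennreal (h (diameter B))) = packing_pre h \<delta> E"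
proof (rule antisym)
  show "packing_pre h \<delta> E \<le> (SUP \<B> \<in> {\<B>. is_packing \<delta> E \<B>}. \<Sum>\<^sub>\<infinity>B\<in>\<B>. ennreal (h (diameter B)))"
    unfolding packing_pre_def
    by (rule SUP_mono) (auto intro!: exI[of _ "_ :: real set set"] simp flip: infsum_finite)
  show "(SUP \<B> \<in> {\<B>. is_packing \<delta> E \<B>}. \<Sum>\<^sub>\<infinity>B\<in>\<B>. ennreal (h (diameter B))) \<le> packing_pre h \<delta> E"
  proof (rule SUP_least)
    fix \<B> assume "\<B> \<in> {\<B>. is_packing \<delta> E \<B>}"
    then have "\<F> \<in> {\<B>. finite \<B> \<and> is_packing \<delta> E \<B>}" if "finite \<F>" "\<F> \<subseteq> \<B>" for \<F>
      using that is_packing_subset by blast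
    then show "(\<Sum>\<^sub>\<infinity>B\<in>\<B>. ennreal (h (diameter B))) \<le> packing_pre h \<delta> E"
      unfolding packing_pre_def
      by (subst nonneg_infsum_complete) (auto intro!: SUP_least SUP_upper)
  qed
qed

lemma packing_pre_mono:
  assumes "\<delta> \<le> \<delta>'"
  shows "packing_pre h \<delta> E \<le> packing_pre h \<delta>' E"
  unfolding packing_pre_def
  by (rule SUP_subset_mono) (use assms in \<open>force simp: is_packing_def\<close>)+

lemma packing_premeasure_eq_INF: "packing_premeasure h E = (INF \<delta>\<in>{0<..}. packing_pre h \<delta> E)"
  unfolding packing_premeasure_def packing_pre_eq_SUP_infsum
  by (rule Lim_at_right_mono) (rule packing_pre_mono)

lemma packing_premeasure_empty: "packing_premeasure h {} = 0"
proof -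
  have "packing_pre h \<delta> {} = 0" for \<delta>
  proof -
    have "\<B> = {}" if "is_packing \<delta> {} \<B>" for \<B>
      using that by (auto simp: is_packing_def)
    then have "{\<B>. finite \<B> \<and> is_packing \<delta> {} \<B>} = {{}}"
      by (auto simp: is_packing_def)
    then show ?thesis
      by (simp add: packing_pre_def)
  qed
  then show ?thesis
    by (simp add: packing_premeasure_eq_INF)
qed

lemma packing_measure_le_premeasure: "packing_measure h E \<le> packing_premeasure h E"
proof -
  define F where "F i = (if i = 0 then E else {})" for i :: nat
  have "packing_measure h E \<le> (\<Sum>i. packing_premeasure h (F i))"
    unfolding packing_measure_def by (rule INF_lower) (auto simp: F_def split: if_splits)
  also have "\<dots> = (\<Sum>i\<in>{0}. packing_premeasure h (F i))"
    by (rule suminf_finite) (auto simp: F_def packing_premeasure_empty)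
  finally show ?thesis
    by (simp add: F_def)
qed

section \<open>Elementary properties of dimension functions\<close>

context
  fixes A :: real and h :: "real \<Rightarrow> real"
  assumes h: "(A, h) \<in> dimension_functions"
begin

lemma dimension_function_domain: "0 < A"
  using h by (simp add: dimension_functions_def inc_cont_fun_def)

lemma dimension_function_0: "h 0 = 0"
  using h by (simp add: dimension_functions_def inc_cont_fun_def)

lemma dimension_function_nonneg: "0 \<le> h x"
  using h by (cases "x \<in> {0<..A}") (auto simp: dimension_functions_def inc_cont_fun_def intro: less_imp_le)

text \<open>The extension by \<open>0\<close> stays monotone to the left of the domain but drops to
  \<open>0\<close> beyond \<open>A\<close>, hence the bound on \<open>y\<close>. This is why scales
  are pushed below \<open>A\<close> later on.\<close>

lemma dimension_function_mono:
  assumes "x \<le> y" "y \<le> A"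
  shows "h x \<le> h y"
proof (cases "0 < x \<and> x \<noteq> y")
  case True
  then have "h x < h y"
    using h assms by (auto simp: dimension_functions_def inc_cont_fun_def strict_mono_on_def)
  then show ?thesis by simp
next
  case False
  then have "x = y \<or> h x = 0"
    using h by (auto simp: dimension_functions_def inc_cont_fun_def)
  then show ?thesis
    using dimension_function_nonneg by auto
qed

lemma dimension_function_doubling:
  obtains c where "0 < c" "\<And>x. 0 < x \<Longrightarrow> 2 * x \<le> A \<Longrightarrow> h (2 * x) \<le> c * h x"
proof -
  obtain \<tau> where "0 < \<tau>" "\<And>x. 0 < x \<Longrightarrow> 2 * x \<le> A \<Longrightarrow> \<tau> * h (2 * x) \<le> h x"
    using h by (auto simp: dimension_functions_def doubling_def)
  then show thesis
    by (intro that[of "1 / \<tau>"]) (auto simp: field_simps)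
qed

end

text \<open>
  Almost all of \<open>packing_pre h \<delta> E\<close> is spent by a finite packing \<open>\<G>\<close>. By the Vitali covering lemma,
  what the closures of its balls leave uncovered is covered by the fivefold enlargements of balls
  that extend \<open>\<G>\<close> to a larger packing, so these contribute little.
\<close>

lemma hausdorff_pre_le_packing_pre:
  assumes h: "(A, h) \<in> dimension_functions" and \<delta>: "0 < \<delta>" "8 * \<delta> \<le> A"
  shows "hausdorff_pre h (5 * \<delta>) E \<le> packing_pre h \<delta> E"
proof (cases "packing_pre h \<delta> E = \<infinity>")
  case False
  obtain c where c: "0 < c" "\<And>x. 0 < x \<Longrightarrow> 2 * x \<le> A \<Longrightarrow> h (2 * x) \<le> c * h x"
    using dimension_function_doubling[OF h] by blast
  note nonneg = dimension_function_nonneg[OF h]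
  \<comment> \<open>Three doublings lead from 2\<rho> to 16\<rho>, past the 10\<rho> of a fivefold
    ball. For \<rho> < \<delta>/2 they stay in the domain because 8\<delta> \<le> A.\<close>
  have enlarge: "h (10 * \<rho>) \<le> c ^ 3 * h (2 * \<rho>)" if "0 < \<rho>" "16 * \<rho> \<le> A" for \<rho>
  proof -
    have "h (10 * \<rho>) \<le> h (2 * (8 * \<rho>))"
      using that by (intro dimension_function_mono[OF h]) auto
    also have "\<dots> \<le> c * h (2 * (4 * \<rho>))"
      using c(2)[of "8 * \<rho>"] that by simp
    also have "\<dots> \<le> c * (c * h (2 * (2 * \<rho>)))"
      using c(1) c(2)[of "4 * \<rho>"] that by (intro mult_left_mono) auto
    also have "\<dots> \<le> c * (c * (c * h (2 * \<rho>)))"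
      using c(1) c(2)[of "2 * \<rho>"] that by (intro mult_left_mono) auto
    finally show ?thesis
      by (simp add: power3_eq_cube mult.assoc)
  qed
  show ?thesis
  proof (rule ennreal_le_epsilon)
    fix e :: real assume "0 < e"
    \<comment> \<open>Enlarging a ball multiplies its cost by at most \<open>c ^ 3\<close>.\<close>
    define e' where "e' = e / c ^ 3"
    have "0 < e'"
      using \<open>0 < e\<close> c(1) by (simp add: e'_def)
    have "{} \<in> {\<B>. finite \<B> \<and> is_packing \<delta> E \<B>}"
      by (auto simp: is_packing_def)
    then have "{\<B>. finite \<B> \<and> is_packing \<delta> E \<B>} \<noteq> {}"
      by blast
    from SUP_approx_ennreal[OF \<open>0 < e'\<close> this packing_pre_def[of h \<delta> E]]
    obtain \<G> where \<G>: "finite \<G>" "is_packing \<delta> E \<G>"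
      and near: "packing_pre h \<delta> E < (\<Sum>B\<in>\<G>. ennreal (h (diameter B))) + ennreal e'"
      using False by auto
    have ball: "\<exists>x\<in>E. \<exists>\<rho>>0. B = ball x \<rho>" "diameter B < \<delta>" if "B \<in> \<G>" for B
      using \<G>(2) that by (auto simp: is_packing_def)
    have bounded: "bounded B" if "B \<in> \<G>" for B
      using ball(1)[OF that] by auto
    \<comment> \<open>Closures are removed, not only the balls: a boundary point of a ball of \<G>
      is the centre of no ball disjoint from it. The closures have the same diameters, so covering
      by them costs nothing extra.\<close>
    define K where "K = {(x, \<rho>). x \<in> E - (\<Union>B\<in>\<G>. closure B) \<and> 0 < \<rho> \<and> \<rho> < \<delta> / 2 \<and>
      (\<forall>B\<in>\<G>. disjnt (cball x \<rho>) B)}"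
    have K_D: "fst i \<in> E" "0 < snd i" "snd i < \<delta> / 2" "\<And>B. B \<in> \<G> \<Longrightarrow> disjnt (cball (fst i) (snd i)) B"
      if "i \<in> K" for i
      using that by (auto simp: K_def)
    have "E - (\<Union>B\<in>\<G>. closure B) \<subseteq> (\<Union>i\<in>K. cball (fst i) (snd i))"
    proof
      fix x assume x: "x \<in> E - (\<Union>B\<in>\<G>. closure B)"
      have "open (- (\<Union>B\<in>\<G>. closure B))"
        using \<G>(1) by (intro open_Compl closed_UN) auto
      then obtain \<epsilon> where \<epsilon>: "0 < \<epsilon>" "cball x \<epsilon> \<subseteq> - (\<Union>B\<in>\<G>. closure B)"
        using x open_contains_cball[of "- (\<Union>B\<in>\<G>. closure B)"] by blast
      define \<rho> where "\<rho> = min \<epsilon> (\<delta> / 4)"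
      have "cball x \<rho> \<subseteq> cball x \<epsilon>"
        by (auto simp: \<rho>_def)
      then have "disjnt (cball x \<rho>) B" if "B \<in> \<G>" for B
        using \<epsilon>(2) that closure_subset by (fastforce simp: disjnt_def)
      then have "(x, \<rho>) \<in> K"
        using x \<epsilon>(1) \<delta>(1) by (auto simp: K_def \<rho>_def)
      then show "x \<in> (\<Union>i\<in>K. cball (fst i) (snd i))"
        using \<epsilon>(1) \<delta>(1) by (force simp: \<rho>_def)
    qed
    then obtain C where C: "countable C" "C \<subseteq> K"
      "pairwise (\<lambda>i j. disjnt (cball (fst i) (snd i)) (cball (fst j) (snd j))) C"
      "E - (\<Union>B\<in>\<G>. closure B) \<subseteq> (\<Union>i\<in>C. cball (fst i) (5 * snd i))"
      using Vitali_covering_lemma_cballs[where K = K and a = fst and r = snd and B = "\<delta> / 2"] K_D by (smt (verit))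
    have C_D: "fst i \<in> E" "0 < snd i" "snd i < \<delta> / 2" "\<And>B. B \<in> \<G> \<Longrightarrow> disjnt (cball (fst i) (snd i)) B"
      if "i \<in> C" for i
      using K_D C(2) that by blast+
    \<comment> \<open>\<G> together with the balls of \<open>D\<close> is still a packing, so its
      weight is at most the supremum. Cancelling the finite weight of \<G> leaves at most
      \<open>e'\<close>.\<close>
    have small: "(\<Sum>i\<in>D. ennreal (h (2 * snd i))) \<le> e'" if D: "finite D" "D \<subseteq> C" for D
    proof -
      define b where "b i = ball (fst i) (snd i)" for i :: "real \<times> real"
      have b_sub: "b i \<subseteq> cball (fst i) (snd i)" for i
        by (auto simp: b_def)
      have disj: "disjnt (b i) (b j)" if "i \<in> D" "j \<in> D" "i \<noteq> j" for i j
        using C(3) that D(2) b_sub unfolding pairwise_def by (meson disjnt_subset1 disjnt_subset2 subsetD)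
      have disj_\<G>: "disjnt (b i) B" if "i \<in> D" "B \<in> \<G>" for i B
        using C_D(4)[of i B] that D(2) b_sub by (meson disjnt_subset1 subsetD)
      have b_nonempty: "b i \<noteq> {}" if "i \<in> D" for i
        using C_D(2)[of i] that D(2) by (auto simp: b_def)
      have inj: "inj_on b D"
        using disj b_nonempty by (fastforce intro!: inj_onI simp: disjnt_def)
      have "\<G> \<inter> b ` D = {}"
        using disj_\<G> b_nonempty by (fastforce simp: disjnt_def)
      then have "(\<Sum>B\<in>\<G>. ennreal (h (diameter B))) + (\<Sum>i\<in>D. ennreal (h (diameter (b i)))) =
          (\<Sum>B\<in>\<G> \<union> b ` D. ennreal (h (diameter B)))"
        using \<G>(1) D(1) inj by (simp add: sum.union_disjoint sum.reindex)
      also have "\<dots> \<le> packing_pre h \<delta> E"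
        unfolding packing_pre_def
      proof (intro SUP_upper CollectI conjI)
        show "is_packing \<delta> E (\<G> \<union> b ` D)"
          unfolding is_packing_def
        proof (intro conjI ballI)
          show "disjoint (\<G> \<union> b ` D)"
            using \<G>(2) disj disj_\<G> unfolding is_packing_def pairwise_def by (auto simp: disjnt_sym)
          fix B assume B: "B \<in> \<G> \<union> b ` D"
          show "\<exists>x\<in>E. \<exists>\<rho>>0. B = ball x \<rho>"
            using B ball C_D D(2) unfolding b_def by blast
          show "diameter B < \<delta>"
          proof (cases "B \<in> \<G>")
            case False
            then obtain i where "i \<in> C" "B = b i"
              using B D(2) by blast
            then show ?thesis
              using C_D(2,3)[of i] by (simp add: b_def)
          qed (rule ball)
        qed
      qed (use \<G>(1) D(1) in auto)
      also have "\<dots> \<le> (\<Sum>B\<in>\<G>. ennreal (h (diameter B))) + ennreal e'"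
        using near by simp
      finally have "(\<Sum>i\<in>D. ennreal (h (diameter (b i)))) \<le> ennreal e'"
        by (subst (asm) ennreal_add_left_cancel_le) (use \<G>(1) in auto)
      moreover have "diameter (b i) = 2 * snd i" if "i \<in> D" for i
        using C_D(2)[of i] D(2) that by (auto simp: b_def)
      ultimately show ?thesis
        by simp
    qed
    \<comment> \<open>Closures have diameter below \<delta> and enlarged balls below 5\<delta>,
      whence the mesh 5\<delta> of the cover.\<close>
    define U where "U = case_sum closure (\<lambda>i::real \<times> real. cball (fst i) (5 * snd i))"
    show "hausdorff_pre h (5 * \<delta>) E \<le> packing_pre h \<delta> E + ennreal e"
    proof (rule hausdorff_pre_le_countable_cover)
      show "countable (\<G> <+> C)"
        using \<G>(1) C(1) by (simp add: countable_finite)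
      show "E \<subseteq> (\<Union>i\<in>\<G> <+> C. U i)"
      proof
        fix x assume "x \<in> E"
        then consider B where "B \<in> \<G>" "x \<in> U (Inl B)" | i where "i \<in> C" "x \<in> U (Inr i)"
          using C(4) unfolding U_def by fastforce
        then show "x \<in> (\<Union>i\<in>\<G> <+> C. U i)"
          by cases blast+
      qed
      show "bounded (U i)" if "i \<in> \<G> <+> C" for i
        using that bounded by (auto simp: U_def bounded_closure)
      show "diameter (U i) \<le> 5 * \<delta>" if "i \<in> \<G> <+> C" for i
        using that ball(2) C_D(2,3) bounded \<delta>(1) by (fastforce simp: U_def diameter_closure)
      fix J assume J: "finite J" "J \<subseteq> \<G> <+> C"
      define D where "D = Inr -` J"
      have D: "finite D" "D \<subseteq> C"
        using J by (auto simp: D_def intro: finite_vimageI)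
      have "J \<subseteq> \<G> <+> D"
        using J(2) by (auto simp: D_def)
      then have "(\<Sum>i\<in>J. ennreal (h (diameter (U i)))) \<le> (\<Sum>i\<in>\<G> <+> D. ennreal (h (diameter (U i))))"
        using \<G>(1) D(1) by (intro sum_mono2) auto
      also have "\<dots> = (\<Sum>B\<in>\<G>. ennreal (h (diameter B))) + (\<Sum>i\<in>D. ennreal (h (10 * snd i)))"
      proof -
        have "diameter (cball (fst i) (5 * snd i)) = 10 * snd i" if "i \<in> D" for i :: "real \<times> real"
          using C_D(2)[of i] D(2) that by auto
        then show ?thesis
          using \<G>(1) D(1) bounded by (simp add: sum.Plus U_def diameter_closure)
      qed
      also have "\<dots> \<le> packing_pre h \<delta> E + ennreal e"
      proof (rule add_mono)
        show "(\<Sum>B\<in>\<G>. ennreal (h (diameter B))) \<le> packing_pre h \<delta> E"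
          unfolding packing_pre_def by (rule SUP_upper) (use \<G> in simp)
        have "(\<Sum>i\<in>D. ennreal (h (10 * snd i))) \<le> (\<Sum>i\<in>D. ennreal (c ^ 3) * ennreal (h (2 * snd i)))"
        proof (rule sum_mono)
          fix i assume "i \<in> D"
          then have "h (10 * snd i) \<le> c ^ 3 * h (2 * snd i)"
            using C_D(2,3)[of i] D(2) \<delta> by (intro enlarge) auto
          then show "ennreal (h (10 * snd i)) \<le> ennreal (c ^ 3) * ennreal (h (2 * snd i))"
            using c(1) nonneg by (simp add: ennreal_mult[symmetric] ennreal_leI)
        qed
        also have "\<dots> \<le> ennreal (c ^ 3) * ennreal e'"
          unfolding sum_distrib_left[symmetric] using small[OF D] by (rule mult_left_mono) simp
        also have "\<dots> = ennreal e"
          using c(1) \<open>0 < e'\<close> by (simp add: ennreal_mult[symmetric] e'_def)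
        finally show "(\<Sum>i\<in>D. ennreal (h (10 * snd i))) \<le> ennreal e" .
      qed
      finally show "(\<Sum>i\<in>J. ennreal (h (diameter (U i)))) \<le> packing_pre h \<delta> E + ennreal e" .
    qed (use \<delta> dimension_function_0[OF h] in auto)
  qed
qed simp

lemma hausdorff_measure_le_packing_premeasure:
  assumes h: "(A, h) \<in> dimension_functions"
  shows "hausdorff_measure h E \<le> packing_premeasure h E"
  unfolding hausdorff_measure_eq_SUP packing_premeasure_eq_INF
proof (intro SUP_least INF_greatest)
  fix \<eta> \<delta> :: real assume pos: "\<eta> \<in> {0<..}" "\<delta> \<in> {0<..}"
  define \<delta>' where "\<delta>' = min \<delta> (min (\<eta> / 5) (A / 8))"
  have \<delta>': "0 < \<delta>'" "8 * \<delta>' \<le> A" "5 * \<delta>' \<le> \<eta>" "\<delta>' \<le> \<delta>"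
    using pos dimension_function_domain[OF h] by (auto simp: \<delta>'_def)
  have "hausdorff_pre h \<eta> E \<le> hausdorff_pre h (5 * \<delta>') E"
    using \<delta>'(3) by (rule hausdorff_pre_antimono)
  also have "\<dots> \<le> packing_pre h \<delta>' E"
    using h \<delta>'(1,2) by (rule hausdorff_pre_le_packing_pre)
  also have "\<dots> \<le> packing_pre h \<delta> E"
    using \<delta>'(4) by (rule packing_pre_mono)
  finally show "hausdorff_pre h \<eta> E \<le> packing_pre h \<delta> E" .
qed

text \<open>The premeasure bound applies to each piece of a decomposition; the pieces are added on
  the Hausdorff side, by countable subadditivity.\<close>

lemma hausdorff_measure_le_packing_measure:
  assumes h: "(A, h) \<in> dimension_functions"
  shows "hausdorff_measure h E \<le> packing_measure h E"
  unfolding packing_measure_def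
proof (rule INF_greatest)
  fix F :: "nat \<Rightarrow> real set" assume "F \<in> {F. E = (\<Union>i. F i)}"
  then have "hausdorff_measure h E \<le> (\<Sum>i. hausdorff_measure h (F i))"
    using hausdorff_measure_UN_le[of h F] by simp
  also have "\<dots> \<le> (\<Sum>i. packing_premeasure h (F i))"
    by (intro suminf_le hausdorff_measure_le_packing_premeasure[OF h]) auto
  finally show "hausdorff_measure h E \<le> (\<Sum>i. packing_premeasure h (F i))" .
qed

subsection \<open>Cantor intervals\<close>

definition mean_length :: "(nat \<Rightarrow> real) \<Rightarrow> nat \<Rightarrow> real" where
  "mean_length a k = tail a (2 ^ k) / 2 ^ k"

definition level :: "nat \<Rightarrow> nat set" where
  "level k = {2 ^ k..<2 ^ Suc k}"

lemma finite_level [simp]: "finite (level k)"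
  by (simp add: level_def)

lemma card_level [simp]: "card (level k) = 2 ^ k"
  by (simp add: level_def)

lemma level_pos: "n \<in> level k \<Longrightarrow> 1 \<le> n"
  using one_le_power[of "2::nat" k] by (simp add: level_def del: one_le_power)

lemma level_Suc_div2: "n \<in> level (Suc k) \<Longrightarrow> n div 2 \<in> level k"
  by (auto simp: level_def)

lemma cantor_set_eq: "cantor_set s a = (\<Inter>k. \<Union>n\<in>level k. cantor_interval s a n)"
proof -
  have "{2 ^ k..2 ^ (k + 1) - 1} = level k" for k
    unfolding level_def by (subst atLeastLessThanSuc_atLeastAtMost[symmetric]) simp
  then show ?thesis
    by (simp add: cantor_set_def)
qed

lemma sum_lessThan_add:
  fixes f :: "nat \<Rightarrow> 'a::comm_monoid_add"
  shows "(\<Sum>j<m + n. f j) = (\<Sum>j<m. f j) + (\<Sum>j<n. f (m + j))"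
  by (induction n) (simp_all add: add.assoc)

locale gap_seq =
  fixes a :: "nat \<Rightarrow> real"
  assumes gap_sequence: "gap_sequence a"
begin

section \<open>Tails, average lengths and interval lengths\<close>

lemma pos: "1 \<le> n \<Longrightarrow> 0 < a n"
  and antimono: "1 \<le> m \<Longrightarrow> m \<le> n \<Longrightarrow> a n \<le> a m"
  and summable: "summable a"
  using gap_sequence unfolding gap_sequence_def by blast+

lemma summable_shift: "summable (\<lambda>j. a (n + j))"
  using summable_ignore_initial_segment[OF summable, of n] by (simp add: add.commute)

lemma tail_pos: "1 \<le> n \<Longrightarrow> 0 < tail a n"
  unfolding tail_def by (rule suminf_pos[OF summable_shift]) (simp add: pos)

lemma tail_antimono: "1 \<le> m \<Longrightarrow> m \<le> n \<Longrightarrow> tail a n \<le> tail a m"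
  unfolding tail_def by (rule suminf_le[OF _ summable_shift summable_shift]) (simp add: antimono)

lemma mean_length_pos: "0 < mean_length a k"
  by (simp add: mean_length_def tail_pos)

lemma tail_div_antimono:
  assumes "1 \<le> m" "m \<le> n"
  shows "tail a n / real n \<le> tail a m / real m"
  using assms tail_antimono[OF assms] tail_pos[of n] by (intro frac_le) auto

text \<open>The tail does not grow while the number of intervals doubles. In general there is no
  bound in the other direction.\<close>

lemma mean_length_Suc: "2 * mean_length a (Suc k) \<le> mean_length a k"
  using tail_antimono[of "2 ^ k" "2 ^ Suc k"] by (simp add: mean_length_def divide_right_mono)

lemma mean_length_add: "2 ^ j * mean_length a (k + j) \<le> mean_length a k"
proof (induction j)
  case (Suc j)
  have "2 ^ Suc j * mean_length a (k + Suc j) = 2 ^ j * (2 * mean_length a (Suc (k + j)))"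
    by simp
  also have "\<dots> \<le> 2 ^ j * mean_length a (k + j)"
    by (intro mult_left_mono mean_length_Suc) simp
  finally show ?case
    using Suc by (rule order_trans)
qed simp

lemma mean_length_less: "mean_length a (Suc k) < mean_length a k"
  using mean_length_Suc[of k] mean_length_pos[of "Suc k"] by simp

lemma mean_length_antimono: "k \<le> k' \<Longrightarrow> mean_length a k' \<le> mean_length a k"
  by (rule lift_Suc_antimono_le) (use mean_length_less less_imp_le in blast)+

lemma mean_length_tendsto: "mean_length a \<longlonglongrightarrow> 0"
proof (rule tendsto_sandwich)
  show "\<forall>\<^sub>F k in sequentially. 0 \<le> mean_length a k"
    by (simp add: less_imp_le mean_length_pos)
  show "\<forall>\<^sub>F k in sequentially. mean_length a k \<le> mean_length a 0 * (1/2) ^ k"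
    using mean_length_add[of _ 0] by (auto simp: field_simps)
  show "(\<lambda>k. mean_length a 0 * (1/2) ^ k) \<longlonglongrightarrow> 0"
    by (intro tendsto_mult_right_zero LIMSEQ_power_zero) simp
qed simp

lemma mean_length_eventually_less: "0 < d \<Longrightarrow> \<forall>\<^sub>F k in sequentially. mean_length a k < d"
  using order_tendstoD(2)[OF mean_length_tendsto] .

text \<open>Stands in for a logarithm: a diameter is located by the two consecutive averages between
  which it falls.\<close>

lemma mean_length_bracket:
  assumes "0 < d" "d \<le> mean_length a k0"
  obtains k where "k0 \<le> k" "mean_length a (Suc k) < d" "d \<le> mean_length a k"
proof -
  obtain N where N: "mean_length a N < d"
    using mean_length_eventually_less[OF assms(1)] by (auto simp: eventually_sequentially)
  define n where "n = (LEAST n. mean_length a n < d)"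
  have n: "mean_length a n < d" "\<And>m. m < n \<Longrightarrow> d \<le> mean_length a m"
    unfolding n_def using N by (auto intro: LeastI dest: not_less_Least)
  have "k0 < n"
    using n(1) assms(2) mean_length_antimono[of n k0] by (cases "k0 < n") auto
  then show thesis
    using that[of "n - 1"] n by simp
qed

text \<open>The blocks from 2^k N up to 2^(k+1) N tile the indices from \<open>N\<close> on. They
  serve as a majorant for a single interval and as the exact total of a row of intervals.\<close>

lemma sums_blocks:
  assumes "1 \<le> N"
  shows "(\<lambda>k. \<Sum>j<2 ^ k * N. a (2 ^ k * N + j)) sums tail a N"
proof -
  have "(\<Sum>k<K. \<Sum>j<2 ^ k * N. a (2 ^ k * N + j)) = (\<Sum>j<2 ^ K * N - N. a (N + j))" for K
  proof (induction K)
    case (Suc K)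
    have N: "N \<le> 2 ^ K * N"
      by simp
    have "(\<Sum>j<2 ^ Suc K * N - N. a (N + j)) = (\<Sum>j<(2 ^ K * N - N) + 2 ^ K * N. a (N + j))"
      using N unfolding power_Suc mult.assoc by (intro sum.cong) auto
    also have "\<dots> = (\<Sum>j<2 ^ K * N - N. a (N + j)) + (\<Sum>j<2 ^ K * N. a (N + ((2 ^ K * N - N) + j)))"
      by (rule sum_lessThan_add)
    finally show ?case
      using Suc N by simp
  qed simp
  moreover have "(\<lambda>K. \<Sum>j<2 ^ K * N - N. a (N + j)) \<longlonglongrightarrow> tail a N"
  proof -
    have "filterlim (\<lambda>K. 2 ^ K * N - N) at_top sequentially"
    proof (rule filterlim_at_top_mono[OF filterlim_ident always_eventually], intro allI)
      fix K
      have "K + 1 \<le> 2 ^ K"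
        by (metis Suc_eq_plus1 Suc_leI less_exp)
      then have "K * N + N \<le> 2 ^ K * N"
        by (metis add_mult_distrib mult_1 mult_le_mono1)
      moreover have "K \<le> K * N"
        using assms by simp
      ultimately show "K \<le> 2 ^ K * N - N"
        by linarith
    qed
    from filterlim_compose[OF summable_LIMSEQ[OF summable_shift[of N]] this]
    show ?thesis
      by (simp add: tail_def)
  qed
  ultimately show ?thesis
    by (simp add: sums_def)
qed

text \<open>The descendants of \<open>n\<close> after \<open>k\<close> steps are the first 2^k
  indices of the block that starts at 2^k n.\<close>

lemma summable_len:
  assumes "1 \<le> n"
  shows "summable (\<lambda>k. \<Sum>j<2 ^ k. a (2 ^ k * n + j))"
proof (rule summable_comparison_test'[OF sums_summable[OF sums_blocks[OF assms]]])
  fix k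
  have "2 ^ k \<le> 2 ^ k * n"
    using assms by simp
  then have "(\<Sum>j<2 ^ k. a (2 ^ k * n + j)) \<le> (\<Sum>j<2 ^ k * n. a (2 ^ k * n + j))"
    using assms by (intro sum_mono2) (auto intro!: less_imp_le[OF pos])
  moreover have "0 \<le> (\<Sum>j<2 ^ k. a (2 ^ k * n + j))"
    using assms by (intro sum_nonneg less_imp_le[OF pos]) (simp add: trans_le_add1)
  ultimately show "norm (\<Sum>j<2 ^ k. a (2 ^ k * n + j)) \<le> (\<Sum>j<2 ^ k * n. a (2 ^ k * n + j))"
    by simp
qed

lemma len_pos:
  assumes "1 \<le> n"
  shows "0 < len a n"
  unfolding len_def using assms
  by (intro suminf_pos[OF summable_len] sum_pos pos) (auto simp: trans_le_add1 lessThan_empty_iff)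

lemma len_antimono:
  assumes "1 \<le> m" "m \<le> n"
  shows "len a n \<le> len a m"
  unfolding len_def using assms
  by (intro suminf_le summable_len sum_mono antimono) (auto simp: trans_le_add1)

text \<open>The descendants of \<open>n\<close> after k + 1 steps are those of 2n after
  \<open>k\<close> steps, followed by those of 2n + 1.\<close>

lemma len_split:
  assumes "1 \<le> n"
  shows "len a n = a n + len a (2 * n) + len a (2 * n + 1)"
proof -
  let ?f = "\<lambda>n k. \<Sum>j<2 ^ k. a (2 ^ k * n + j)"
  have split: "?f n (Suc k) = ?f (2 * n) k + ?f (2 * n + 1) k" for k
    using sum_lessThan_add[of "\<lambda>j. a (2 ^ Suc k * n + j)" "2 ^ k" "2 ^ k"]
    by (simp add: algebra_simps mult_2)
  have "len a n = ?f n 0 + (\<Sum>k. ?f n (Suc k))"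
    unfolding len_def using suminf_split_head[OF summable_len[OF assms]] by simp
  also have "(\<Sum>k. ?f n (Suc k)) = len a (2 * n) + len a (2 * n + 1)"
    unfolding split len_def using assms by (intro suminf_add[symmetric] summable_len) auto
  finally show ?thesis
    by simp
qed

text \<open>After \<open>k\<close> steps the descendants of N, ..., 2N - 1 fill exactly the block
  \<open>k\<close> of \<open>sums_blocks\<close>. For \<open>N\<close> a power of two this
  identifies \<open>mean_length\<close> as the average length of a level.\<close>

lemma sum_len:
  assumes "1 \<le> N"
  shows "(\<Sum>n\<in>{N..<2 * N}. len a n) = tail a N"
proof -
  have "(\<Sum>n\<in>{N..<2 * N}. len a n) = (\<Sum>k. \<Sum>n\<in>{N..<2 * N}. \<Sum>j<2 ^ k. a (2 ^ k * n + j))"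
    unfolding len_def using assms by (intro suminf_sum[symmetric] summable_len) auto
  also have "\<dots> = (\<Sum>k. \<Sum>j<2 ^ k * N. a (2 ^ k * N + j))"
  proof (rule suminf_cong)
    fix k
    have "(\<Sum>n\<in>{N..<2 * N}. \<Sum>j<2 ^ k. a (2 ^ k * n + j)) =
        (\<Sum>n<N. \<Sum>j<2 ^ k. a (2 ^ k * N + (n * 2 ^ k + j)))"
      by (rule sum.reindex_bij_witness[of _ "\<lambda>n. N + n" "\<lambda>n. n - N"])
        (auto simp: le_iff_add algebra_simps)
    also have "\<dots> = (\<Sum>n<N. \<Sum>j = n * 2 ^ k..<n * 2 ^ k + 2 ^ k. a (2 ^ k * N + j))"
    proof (rule sum.cong[OF refl])
      fix n
      show "(\<Sum>j<2 ^ k. a (2 ^ k * N + (n * 2 ^ k + j))) =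
          (\<Sum>j = n * 2 ^ k..<n * 2 ^ k + 2 ^ k. a (2 ^ k * N + j))"
        by (rule sum.reindex_bij_witness[of _ "\<lambda>j. j - n * 2 ^ k" "\<lambda>j. n * 2 ^ k + j"]) auto
    qed
    also have "\<dots> = (\<Sum>j<N * 2 ^ k. a (2 ^ k * N + j))"
      by (rule sum.nat_group)
    finally show "(\<Sum>n\<in>{N..<2 * N}. \<Sum>j<2 ^ k. a (2 ^ k * n + j)) =
        (\<Sum>j<2 ^ k * N. a (2 ^ k * N + j))"
      by (simp add: mult.commute)
  qed
  also have "\<dots> = tail a N"
    using sums_blocks[OF assms] by (rule sums_unique[symmetric])
  finally show ?thesis .
qed

lemma mean_length_le_len:
  assumes "n \<in> level k"
  shows "mean_length a (Suc k) \<le> len a n"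
proof -
  have "tail a (2 ^ Suc k) = (\<Sum>m\<in>{(2::nat) ^ Suc k..<2 * 2 ^ Suc k}. len a m)"
    by (rule sum_len[symmetric]) simp
  also have "\<dots> \<le> (\<Sum>m\<in>{(2::nat) ^ Suc k..<2 * 2 ^ Suc k}. len a n)"
    using assms by (intro sum_mono len_antimono) (auto simp: level_def intro: level_pos[OF assms])
  finally show ?thesis
    by (simp add: mean_length_def field_simps)
qed

lemma len_le_mean_length:
  assumes "n \<in> level (Suc k)"
  shows "len a n \<le> mean_length a k"
proof -
  have "(\<Sum>m\<in>{(2::nat) ^ k..<2 * 2 ^ k}. len a n) \<le> (\<Sum>m\<in>{(2::nat) ^ k..<2 * 2 ^ k}. len a m)"
    using assms by (intro sum_mono len_antimono) (auto simp: level_def intro: order_trans[OF one_le_power])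
  also have "\<dots> = tail a (2 ^ k)"
    by (rule sum_len) simp
  finally show ?thesis
    by (simp add: mean_length_def field_simps)
qed

end

locale cantor = gap_seq +
  fixes s :: real
begin

section \<open>Nesting and order of Cantor intervals\<close>

lemma left_end_double: "1 \<le> n \<Longrightarrow> left_end s a (2 * n) = left_end s a n"
  by (subst left_end.simps) simp

lemma left_end_double_Suc:
  "1 \<le> n \<Longrightarrow> left_end s a (2 * n + 1) = left_end s a n + len a (2 * n) + a n"
  by (subst left_end.simps) simp

lemma left_end_in_interval: "1 \<le> n \<Longrightarrow> left_end s a n \<in> cantor_interval s a n"
  using len_pos[of n] by (simp add: cantor_interval_def)

lemma interval_subset_parent:
  assumes "1 \<le> n div 2"
  shows "cantor_interval s a n \<subseteq> cantor_interval s a (n div 2)"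
proof -
  define m where "m = n div 2"
  have m: "1 \<le> m" "0 < a m" "0 < len a (2 * m)" "0 < len a (2 * m + 1)"
    using assms by (auto simp: m_def intro!: pos len_pos)
  have "n = 2 * m \<or> n = 2 * m + 1"
    unfolding m_def by presburger
  then show ?thesis
    unfolding m_def[symmetric] cantor_interval_def
    using m len_split[OF m(1)] left_end_double[OF m(1)] left_end_double_Suc[OF m(1)]
    by (auto simp del: One_nat_def)
qed

text \<open>Neighbours with a common parent are separated by its gap. Neighbours with different
  parents share their facing endpoints with these parents, which the induction hypothesis
  separates.\<close>

lemma interval_order_Suc:
  "n \<in> level k \<Longrightarrow> Suc n \<in> level k \<Longrightarrow> left_end s a n + len a n < left_end s a (Suc n)"
proof (induction k arbitrary: n)
  case 0
  then show ?case by (simp add: level_def)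
next
  case (Suc k)
  define m where "m = n div 2"
  have m: "m \<in> level k" "1 \<le> m"
    using level_Suc_div2[OF Suc.prems(1)] level_pos by (auto simp: m_def)
  have a: "0 < a m"
    using m(2) by (rule pos)
  show ?case
  proof (cases "even n")
    case True
    then have n: "n = 2 * m"
      by (simp add: m_def)
    then show ?thesis
      using left_end_double[OF m(2)] left_end_double_Suc[OF m(2)] a by simp
  next
    case False
    then have n: "n = 2 * m + 1" "Suc n = 2 * Suc m"
      by (auto simp: m_def)
    then have "Suc m \<in> level k"
      using level_Suc_div2[OF Suc.prems(2)] by simp
    then have "left_end s a m + len a m < left_end s a (Suc m)"
      using Suc.IH m(1) by blast
    moreover have "left_end s a (Suc n) = left_end s a (Suc m)"
      unfolding n(2) by (rule left_end_double) simp
    ultimately show ?thesis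
      using n(1) left_end_double_Suc[OF m(2)] len_split[OF m(2)] by simp
  qed
qed

lemma interval_order:
  assumes "m < n" "m \<in> level k" "n \<in> level k"
  shows "left_end s a m + len a m < left_end s a n"
  using assms(1,3)
proof (induction n)
  case (Suc n)
  have n: "n \<in> level k"
    using Suc.prems assms(2) by (auto simp: level_def)
  show ?case
  proof (cases "m = n")
    case True
    then show ?thesis
      using interval_order_Suc n Suc.prems(2) by simp
  next
    case False
    then have "left_end s a m + len a m < left_end s a n"
      using Suc n by simp
    also have "\<dots> < left_end s a n + len a n"
      using len_pos level_pos[OF n] by simp
    also have "\<dots> < left_end s a (Suc n)"
      using n Suc.prems(2) by (rule interval_order_Suc)
    finally show ?thesis .
  qed
qed simp

lemma interval_unique:
  assumes "m \<in> level k" "n \<in> level k" "x \<in> cantor_interval s a m" "x \<in> cantor_interval s a n"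
  shows "m = n"
  using assms interval_order[of m n k] interval_order[of n m k]
  by (cases m n rule: linorder_cases) (auto simp: cantor_interval_def)

lemma cantor_setE:
  assumes "x \<in> cantor_set s a"
  obtains n where "n \<in> level k" "x \<in> cantor_interval s a n"
  using assms by (auto simp: cantor_set_eq)

text \<open>
  Each \<open>t \<in> [1, 2)\<close> is the address of a point of the Cantor set, whose interval of level \<open>k\<close> has index
  \<open>\<lfloor>2 ^ k * t\<rfloor>\<close>. So a cover of the Cantor set by such intervals gives a cover of \<open>[1, 2)\<close> by dyadic
  intervals, disjoint intervals give disjoint dyadic intervals, and Lebesgue measure applies.
\<close>

definition address :: "real \<Rightarrow> nat \<Rightarrow> nat" where
  "address t k = nat \<lfloor>2 ^ k * t\<rfloor>"

lemma address_Suc_div2: "0 \<le> t \<Longrightarrow> address t (Suc k) div 2 = address t k"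
  using floor_divide_real_eq_div[of 2 "2 ^ Suc k * t"]
  by (simp add: address_def nat_div_distrib)

lemma address_eq_iff: "0 \<le> t \<Longrightarrow> address t k = n \<longleftrightarrow> real n / 2 ^ k \<le> t \<and> t < (real n + 1) / 2 ^ k"
  unfolding address_def by (simp add: nat_eq_iff floor_eq_iff field_simps)

lemma address_level:
  assumes "1 \<le> t" "t < 2"
  shows "address t k \<in> level k"
proof -
  have "real (address t k) \<le> 2 ^ k * t" "2 ^ k * t < real (address t k) + 1"
    using address_eq_iff[of t k "address t k"] assms(1) by (simp_all add: field_simps)
  moreover have "2 ^ k \<le> 2 ^ k * t" "2 ^ k * t < 2 * 2 ^ k"
    using assms by simp_all
  ultimately have "2 ^ k < real (address t k) + 1" "real (address t k) < 2 * 2 ^ k"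
    by linarith+
  then have "real (2 ^ k) < real (address t k + 1)" "real (address t k) < real (2 ^ Suc k)"
    by simp_all
  then show ?thesis
    unfolding of_nat_less_iff by (simp add: level_def)
qed

lemma exists_point_with_address:
  assumes t: "1 \<le> t" "t < 2"
  obtains x where "x \<in> cantor_set s a" "\<And>k. x \<in> cantor_interval s a (address t k)"
proof -
  let ?I = "\<lambda>k. cantor_interval s a (address t k)"
  have "(\<Inter>k. ?I k) \<noteq> {}"
  proof (rule compact_nest)
    show "compact (?I k)" for k
      by (simp add: cantor_interval_def)
    show "?I k \<noteq> {}" for k
      using left_end_in_interval[OF level_pos[OF address_level[OF t]]] by blast
    have "?I (Suc k) \<subseteq> ?I k" for k
      using interval_subset_parent[of "address t (Suc k)"] address_Suc_div2[of t k] t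
        level_pos[OF address_level[OF t]] by simp
    then show "?I n \<subseteq> ?I m" if "m \<le> n" for m n
      using that by (rule lift_Suc_antimono_le)
  qed
  then show thesis
    using that address_level[OF t] by (fastforce simp: cantor_set_eq)
qed

text \<open>By \<open>address_eq_iff\<close>, the nonnegative \<open>t\<close> whose address at
  level \<open>k\<close> is \<open>n\<close>.\<close>

definition dyadic :: "nat \<Rightarrow> nat \<Rightarrow> real set" where
  "dyadic k n = {real n / 2 ^ k..<(real n + 1) / 2 ^ k}"

lemma emeasure_dyadic: "emeasure lborel (dyadic k n) = ennreal (1 / 2 ^ k)"
proof -
  have "(real n + 1) / 2 ^ k - real n / 2 ^ k = 1 / 2 ^ k"
    by (simp add: field_simps)
  then show ?thesis
    by (simp add: dyadic_def divide_right_mono)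
qed

lemma dyadic_subset: "n \<in> level k \<Longrightarrow> dyadic k n \<subseteq> {1..<2}"
proof -
  assume "n \<in> level k"
  then have "real (2 ^ k) \<le> real n" "real (n + 1) \<le> real (2 ^ Suc k)"
    unfolding of_nat_le_iff by (auto simp: level_def)
  then have "1 \<le> real n / 2 ^ k" "(real n + 1) / 2 ^ k \<le> 2"
    by (simp_all add: field_simps)
  then show ?thesis
    by (auto simp: dyadic_def)
qed

text \<open>An interval of level \<open>k\<close> has mass 1/2^k, as under the uniform measure on
  the Cantor set. The level may depend on \<open>i\<close>: each covering set, or each piece of a
  decomposition, will choose its own.\<close>

lemma cover_weight_ge_1:
  assumes cover: "cantor_set s a \<subseteq> (\<Union>i::nat. \<Union>n\<in>M i. cantor_interval s a n)"
    and M: "\<And>i. M i \<subseteq> level (k i)"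
  shows "1 \<le> (\<Sum>i. ennreal (card (M i) / 2 ^ k i))"
proof -
  have finite: "finite (M i)" for i
    using M finite_level by (rule finite_subset)
  let ?D = "\<lambda>i. \<Union>n\<in>M i. dyadic (k i) n"
  have sets: "?D i \<in> sets lborel" for i
    using finite by (auto simp: dyadic_def)
  have "{1..<2::real} \<subseteq> (\<Union>i. ?D i)"
  proof
    fix t :: real assume "t \<in> {1..<2}"
    then have t: "1 \<le> t" "t < 2"
      by auto
    obtain x where x: "x \<in> cantor_set s a" "\<And>k. x \<in> cantor_interval s a (address t k)"
      using exists_point_with_address[OF t] by blast
    obtain i n where n: "n \<in> M i" "x \<in> cantor_interval s a n"
      using cover x(1) by blast
    then have "address t (k i) = n"
      using M x(2) address_level[OF t] interval_unique by blast
    then have "t \<in> dyadic (k i) n"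
      using t by (simp add: address_eq_iff dyadic_def)
    then show "t \<in> (\<Union>i. ?D i)"
      using n(1) by blast
  qed
  then have "emeasure lborel {1..<2::real} \<le> emeasure lborel (\<Union>i. ?D i)"
    using sets by (intro emeasure_mono) auto
  also have "\<dots> \<le> (\<Sum>i. emeasure lborel (?D i))"
    using sets by (intro emeasure_subadditive_countably) auto
  also have "\<dots> \<le> (\<Sum>i. ennreal (card (M i) / 2 ^ k i))"
  proof (intro suminf_le summableI)
    fix i
    have "emeasure lborel (?D i) \<le> (\<Sum>n\<in>M i. emeasure lborel (dyadic (k i) n))"
      using finite by (intro emeasure_subadditive_finite) (auto simp: dyadic_def)
    also have "\<dots> = ennreal (card (M i) / 2 ^ k i)"
      by (simp add: emeasure_dyadic ennreal_of_nat_eq_real_of_nat ennreal_mult[symmetric])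
    finally show "emeasure lborel (?D i) \<le> ennreal (card (M i) / 2 ^ k i)" .
  qed
  finally show ?thesis
    by simp
qed

lemma packing_weight_le_1:
  assumes "finite S" and n: "\<And>i. i \<in> S \<Longrightarrow> n i \<in> level (k i)"
    and disj: "\<And>i j. i \<in> S \<Longrightarrow> j \<in> S \<Longrightarrow> i \<noteq> j \<Longrightarrow>
      cantor_interval s a (n i) \<inter> cantor_interval s a (n j) = {}"
  shows "(\<Sum>i\<in>S. ennreal (1 / 2 ^ k i)) \<le> 1"
proof -
  have "disjoint_family_on (\<lambda>i. dyadic (k i) (n i)) S"
    unfolding disjoint_family_on_def
  proof (intro ballI impI equals0I)
    fix i j t assume ij: "i \<in> S" "j \<in> S" "i \<noteq> j" and t: "t \<in> dyadic (k i) (n i) \<inter> dyadic (k j) (n j)"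
    have t12: "1 \<le> t" "t < 2"
      using dyadic_subset[OF n[OF ij(1)]] t by auto
    obtain x where x: "\<And>k. x \<in> cantor_interval s a (address t k)"
      using exists_point_with_address[OF t12] by blast
    have "address t (k i) = n i" "address t (k j) = n j"
      using t t12 by (auto simp: address_eq_iff dyadic_def)
    then show False
      using x[of "k i"] x[of "k j"] disj[OF ij] by auto
  qed
  then have "(\<Sum>i\<in>S. emeasure lborel (dyadic (k i) (n i))) = emeasure lborel (\<Union>i\<in>S. dyadic (k i) (n i))"
    using \<open>finite S\<close> by (intro sum_emeasure) (auto simp: dyadic_def)
  also have "\<dots> \<le> emeasure lborel {1..<2::real}"
    using n dyadic_subset by (intro emeasure_mono UN_least) auto
  finally show ?thesis
    by (simp add: emeasure_dyadic)
qed

section \<open>Intervals meeting a given set\<close>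

definition meeting :: "real set \<Rightarrow> nat \<Rightarrow> nat set" where
  "meeting F k = {n \<in> level k. cantor_interval s a n \<inter> F \<noteq> {}}"

lemma finite_meeting [simp]: "finite (meeting F k)"
  by (simp add: meeting_def)

lemma meeting_cover:
  assumes "cantor_set s a \<subseteq> (\<Union>i. F i)"
  shows "cantor_set s a \<subseteq> (\<Union>i. \<Union>n\<in>meeting (F i) (k i). cantor_interval s a n)"
proof
  fix x assume x: "x \<in> cantor_set s a"
  then obtain i where i: "x \<in> F i"
    using assms by blast
  obtain n where "n \<in> level (k i)" "x \<in> cantor_interval s a n"
    using x by (rule cantor_setE)
  with i have "n \<in> meeting (F i) (k i)"
    by (auto simp: meeting_def)
  with \<open>x \<in> cantor_interval s a n\<close> show "x \<in> (\<Union>i. \<Union>n\<in>meeting (F i) (k i). cantor_interval s a n)"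
    by blast
qed

text \<open>A set of diameter at most \<open>mean_length a (Suc k)\<close> cannot bridge an interval of level \<open>k\<close>.\<close>

lemma card_meeting_le_2:
  assumes F: "bounded F" "diameter F \<le> mean_length a (Suc k)"
  shows "card (meeting F k) \<le> 2"
proof (cases "meeting F k = {}")
  case False
  let ?M = "meeting F k"
  have "?M \<subseteq> {Min ?M, Max ?M}"
  proof (rule subsetI, rule ccontr)
    fix n assume n: "n \<in> ?M" "n \<notin> {Min ?M, Max ?M}"
    define m m' where "m = Min ?M" and "m' = Max ?M"
    have mem: "m \<in> ?M" "m' \<in> ?M"
      using False by (auto simp: m_def m'_def)
    then have lev: "m \<in> level k" "n \<in> level k" "m' \<in> level k"
      using n(1) by (auto simp: meeting_def)
    have "m < n" "n < m'"
      using n Min_le[OF finite_meeting n(1)] Max_ge[OF finite_meeting n(1)]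
      by (auto simp: m_def m'_def le_less)
    then have order: "left_end s a m + len a m < left_end s a n" "left_end s a n + len a n < left_end s a m'"
      using interval_order lev by blast+
    obtain x y where xy: "x \<in> F" "x \<in> cantor_interval s a m" "y \<in> F" "y \<in> cantor_interval s a m'"
      using mem by (auto simp: meeting_def)
    then have "len a n < dist x y"
      using order by (auto simp: cantor_interval_def dist_real_def)
    also have "\<dots> \<le> diameter F"
      using F(1) xy(1,3) by (rule diameter_bounded_bound)
    also have "\<dots> \<le> len a n"
      using F(2) mean_length_le_len[OF lev(2)] by simp
    finally show False
      by simp
  qed
  then have "card ?M \<le> card {Min ?M, Max ?M}"
    by (intro card_mono) auto
  also have "\<dots> \<le> 2"
    by (simp add: card_insert_if)
  finally show ?thesis .
qed simp

end

subsection \<open>Measures of the Cantor set\<close>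

context cantor
begin

lemma eventually_mean_length_le: "0 < d \<Longrightarrow> \<forall>\<^sub>F k in sequentially. mean_length a k \<le> d"
  using mean_length_eventually_less[of d] by (auto elim: eventually_mono)

text \<open>Each \<delta> needs only one good level, so infinitely many good \<open>k\<close> are
  enough. The cover uses level k + 1, whose lengths are at most s_k; its 2^(k+1) intervals give the
  factor 2.\<close>

lemma hausdorff_measure_cantor_le:
  assumes h: "(A, h) \<in> dimension_functions" and "0 \<le> L"
    and freq: "\<exists>\<^sub>F k in sequentially. 2 ^ k * h (mean_length a k) \<le> L"
  shows "hausdorff_measure h (cantor_set s a) \<le> ennreal (2 * L)"
  unfolding hausdorff_measure_eq_SUP
proof (rule SUP_least)
  fix \<delta> :: real assume "\<delta> \<in> {0<..}"
  then have "0 < min \<delta> A"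
    using dimension_function_domain[OF h] by simp
  then have "\<forall>\<^sub>F k in sequentially. mean_length a k \<le> min \<delta> A"
    by (rule eventually_mean_length_le)
  from frequently_ex[OF frequently_eventually_frequently[OF freq this]]
  obtain k where k: "2 ^ k * h (mean_length a k) \<le> L" "mean_length a k \<le> min \<delta> A"
    by auto
  have diam: "diameter (cantor_interval s a n) = len a n" if "n \<in> level (Suc k)" for n
    using len_pos[OF level_pos[OF that]] by (simp add: cantor_interval_def)
  show "hausdorff_pre h \<delta> (cantor_set s a) \<le> ennreal (2 * L)"
  proof (rule hausdorff_pre_le_countable_cover)
    show "countable (level (Suc k))"
      by (simp add: countable_finite)
    show "cantor_set s a \<subseteq> (\<Union>n\<in>level (Suc k). cantor_interval s a n)"
      by (auto elim: cantor_setE)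
    show "diameter (cantor_interval s a n) \<le> \<delta>" if "n \<in> level (Suc k)" for n
      using k(2) len_le_mean_length[OF that] diam[OF that] by simp
    fix J assume J: "finite J" "J \<subseteq> level (Suc k)"
    have "(\<Sum>n\<in>J. ennreal (h (diameter (cantor_interval s a n)))) \<le>
        (\<Sum>n\<in>level (Suc k). ennreal (h (diameter (cantor_interval s a n))))"
      using J by (intro sum_mono2) auto
    also have "\<dots> \<le> (\<Sum>n\<in>level (Suc k). ennreal (h (mean_length a k)))"
      using k(2) len_le_mean_length diam
      by (intro sum_mono ennreal_leI dimension_function_mono[OF h]) auto
    also have "\<dots> = ennreal (2 * (2 ^ k * h (mean_length a k)))"
      using dimension_function_nonneg[OF h]
      by (simp add: ennreal_of_nat_eq_real_of_nat ennreal_mult[symmetric] mult.assoc)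
    also have "\<dots> \<le> ennreal (2 * L)"
      using k(1) by (intro ennreal_leI) simp
    finally show "(\<Sum>n\<in>J. ennreal (h (diameter (cantor_interval s a n)))) \<le> ennreal (2 * L)" .
  qed (use \<open>\<delta> \<in> {0<..}\<close> dimension_function_0[OF h] in \<open>auto simp: cantor_interval_def\<close>)
qed

text \<open>A set of diameter d with s_(k+1) < d \<le> s_k meets at most two intervals of level k -
  1. Their mass 2/2^(k-1) = 8/2^(k+1) is at most (8/L) h(s_(k+1)), hence at most (8/L) h(d), while
  the masses for a whole cover sum to at least 1.\<close>

lemma hausdorff_measure_cantor_ge:
  assumes h: "(A, h) \<in> dimension_functions" and "0 < L"
    and ev: "\<forall>\<^sub>F k in sequentially. L \<le> 2 ^ k * h (mean_length a k)"
  shows "ennreal (L / 8) \<le> hausdorff_measure h (cantor_set s a)"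
proof -
  have "\<forall>\<^sub>F k in sequentially. L \<le> 2 ^ k * h (mean_length a k) \<and> mean_length a k \<le> A \<and> 1 \<le> k"
    using ev eventually_mean_length_le[OF dimension_function_domain[OF h]] eventually_ge_at_top
    by (intro eventually_conj)
  then obtain k0 where k0: "\<And>k. k0 \<le> k \<Longrightarrow> L \<le> 2 ^ k * h (mean_length a k)"
      "\<And>k. k0 \<le> k \<Longrightarrow> mean_length a k \<le> A" "1 \<le> k0"
    by (auto simp: eventually_sequentially)
  note nonneg = dimension_function_nonneg[OF h]
  have "ennreal (L / 8) \<le> hausdorff_pre h (mean_length a k0) (cantor_set s a)"
    unfolding hausdorff_pre_def
  proof (rule INF_greatest)
    fix F :: "nat \<Rightarrow> real set"
    assume "F \<in> {F. cantor_set s a \<subseteq> (\<Union>i. F i) \<and> (\<forall>i. bounded (F i) \<and> diameter (F i) \<le> mean_length a k0)}"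
    then have F: "cantor_set s a \<subseteq> (\<Union>i. F i)" "\<And>i. bounded (F i)" "\<And>i. diameter (F i) \<le> mean_length a k0"
      by auto
    show "ennreal (L / 8) \<le> (\<Sum>i. ennreal (h (diameter (F i))))"
    proof (rule ennreal_le_epsilon)
      fix e :: real assume "0 < e"
      \<comment> \<open>The second summand pays for sets of diameter \<open>0\<close>, which cost
        nothing under \<open>h\<close> but may meet an interval at every level. It totals 8e/L,
        which the final factor L/8 turns into \<open>e\<close>.\<close>
      define w where "w i = 8 / L * h (diameter (F i)) + 8 * e / L * (1/2) ^ Suc i" for i
      have "\<exists>k. card (meeting (F i) k) / 2 ^ k \<le> w i" for i
      proof (cases "diameter (F i) = 0")
        case True
        have "0 < w i"
          using \<open>0 < e\<close> \<open>0 < L\<close> nonneg[of "diameter (F i)"] by (auto simp: w_def intro!: add_nonneg_pos)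
        then obtain k where k: "(1/2) ^ k < w i / 2"
          using real_arch_pow_inv[of "w i / 2" "1/2"] by auto
        have "card (meeting (F i) k) \<le> 2"
          using F(2) True mean_length_pos[of "Suc k"] by (intro card_meeting_le_2) auto
        then have "card (meeting (F i) k) / 2 ^ k \<le> 2 / 2 ^ k"
          by (intro divide_right_mono) auto
        also have "\<dots> \<le> w i"
          using k by (simp add: power_one_over)
        finally show ?thesis
          by blast
      next
        case False
        then have "0 < diameter (F i)"
          using diameter_ge_0[OF F(2)[of i]] by simp
        then obtain k where k: "k0 \<le> k" "mean_length a (Suc k) < diameter (F i)" "diameter (F i) \<le> mean_length a k"
          using F(3) by (rule mean_length_bracket)
        \<comment> \<open>\<open>card_meeting_le_2\<close> at level \<open>j\<close> asks for a
          diameter of at most \<open>mean_length a (Suc j)\<close>; \<open>1 \<le> k0\<close> makes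
          k - 1 a true predecessor.\<close>
        define j where "j = k - 1"
        have j: "k = Suc j"
          using k(1) k0(3) by (simp add: j_def)
        have "card (meeting (F i) j) \<le> 2"
          using F(2) k(3) j by (intro card_meeting_le_2) auto
        then have "card (meeting (F i) j) / 2 ^ j \<le> 2 / 2 ^ j"
          by (intro divide_right_mono) auto
        also have "\<dots> = 8 / L * (L / 2 ^ Suc k)"
          using \<open>0 < L\<close> by (simp add: j)
        also have "\<dots> \<le> 8 / L * h (mean_length a (Suc k))"
          using k0(1)[of "Suc k"] k(1) \<open>0 < L\<close> by (intro mult_left_mono) (auto simp: field_simps)
        also have "\<dots> \<le> 8 / L * h (diameter (F i))"
          using k k0(2)[of k] \<open>0 < L\<close> by (intro mult_left_mono dimension_function_mono[OF h]) auto
        also have "\<dots> \<le> w i"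
          using \<open>0 < e\<close> \<open>0 < L\<close> by (simp add: w_def)
        finally show ?thesis
          by blast
      qed
      then obtain k where k: "\<And>i. card (meeting (F i) (k i)) / 2 ^ k i \<le> w i"
        by metis
      have "cantor_set s a \<subseteq> (\<Union>i. \<Union>n\<in>meeting (F i) (k i). cantor_interval s a n)"
        using F(1) by (rule meeting_cover)
      then have "1 \<le> (\<Sum>i. ennreal (card (meeting (F i) (k i)) / 2 ^ k i))"
        by (rule cover_weight_ge_1) (auto simp: meeting_def)
      also have "\<dots> \<le> (\<Sum>i. ennreal (w i))"
        using k by (intro suminf_le ennreal_leI) auto
      also have "\<dots> = (\<Sum>i. ennreal (8 / L * h (diameter (F i)))) + ennreal (8 * e / L)"
        unfolding w_def using \<open>0 < e\<close> \<open>0 < L\<close> nonneg by (intro suminf_add_half_powers_ennreal) auto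
      also have "(\<Sum>i. ennreal (8 / L * h (diameter (F i)))) = ennreal (8 / L) * (\<Sum>i. ennreal (h (diameter (F i))))"
        using \<open>0 < L\<close> nonneg
        by (subst ennreal_suminf_cmult[symmetric], intro suminf_cong ennreal_mult) auto
      finally have "ennreal (L / 8) * 1 \<le>
          ennreal (L / 8) * (ennreal (8 / L) * (\<Sum>i. ennreal (h (diameter (F i)))) + ennreal (8 * e / L))"
        by (rule mult_left_mono) simp
      then show "ennreal (L / 8) \<le> (\<Sum>i. ennreal (h (diameter (F i)))) + ennreal e"
        using \<open>0 < e\<close> \<open>0 < L\<close>
        by (simp add: distrib_left mult.assoc[symmetric] ennreal_mult[symmetric])
    qed
  qed
  also have "\<dots> \<le> hausdorff_measure h (cantor_set s a)"
    using mean_length_pos by (rule hausdorff_pre_le_measure)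
  finally show ?thesis .
qed

text \<open>If s_(k+1) < 2\<rho> \<le> s_k, the interval of level k + 3 at the centre has length at
  most s_(k+2) \<le> s_(k+1)/2 < \<rho>, so the ball contains it. The three extra levels cost the
  factor 8, and disjoint balls contain disjoint intervals.\<close>

lemma packing_premeasure_cantor_le:
  assumes h: "(A, h) \<in> dimension_functions" and "0 \<le> L"
    and ev: "\<forall>\<^sub>F k in sequentially. 2 ^ k * h (mean_length a k) \<le> L"
  shows "packing_premeasure h (cantor_set s a) \<le> ennreal (8 * L)"
proof -
  have "\<forall>\<^sub>F k in sequentially. 2 ^ k * h (mean_length a k) \<le> L \<and> mean_length a k \<le> A"
    using ev eventually_mean_length_le[OF dimension_function_domain[OF h]] by (rule eventually_conj)
  then obtain k0 where k0: "\<And>k. k0 \<le> k \<Longrightarrow> 2 ^ k * h (mean_length a k) \<le> L"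
      "\<And>k. k0 \<le> k \<Longrightarrow> mean_length a k \<le> A"
    by (auto simp: eventually_sequentially)
  have "packing_premeasure h (cantor_set s a) \<le> packing_pre h (mean_length a k0) (cantor_set s a)"
    unfolding packing_premeasure_eq_INF by (rule INF_lower) (simp add: mean_length_pos)
  also have "\<dots> \<le> ennreal (8 * L)"
    unfolding packing_pre_def
  proof (rule SUP_least)
    fix \<B> assume "\<B> \<in> {\<B>. finite \<B> \<and> is_packing (mean_length a k0) (cantor_set s a) \<B>}"
    then have \<B>: "finite \<B>" "disjoint \<B>" "\<And>B. B \<in> \<B> \<Longrightarrow> \<exists>x\<in>cantor_set s a. \<exists>\<rho>>0. B = ball x \<rho>"
        "\<And>B. B \<in> \<B> \<Longrightarrow> diameter B < mean_length a k0"
      by (auto simp: is_packing_def)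
    have "\<exists>k n. n \<in> level k \<and> cantor_interval s a n \<subseteq> B \<and> h (diameter B) \<le> 8 * L * (1 / 2 ^ k)"
      if B: "B \<in> \<B>" for B
    proof -
      obtain x \<rho> where x: "x \<in> cantor_set s a" "0 < \<rho>" "B = ball x \<rho>"
        using \<B>(3)[OF B] by blast
      then have "0 < diameter B"
        by simp
      then obtain k where k: "k0 \<le> k" "mean_length a (Suc k) < diameter B" "diameter B \<le> mean_length a k"
        using \<B>(4)[OF B] by (elim mean_length_bracket) auto
      obtain n where n: "n \<in> level (k + 3)" "x \<in> cantor_interval s a n"
        using x(1) by (rule cantor_setE)
      have "len a n \<le> mean_length a (Suc (Suc k))"
        using n(1) by (intro len_le_mean_length) (simp add: numeral_3_eq_3)
      also have "\<dots> < \<rho>"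
        using mean_length_Suc[of "Suc k"] k(2) x by simp
      finally have "cantor_interval s a n \<subseteq> B"
        using n(2) by (auto simp: x(3) cantor_interval_def dist_real_def)
      moreover have "h (diameter B) \<le> h (mean_length a k)"
        using k(1,3) k0(2) by (intro dimension_function_mono[OF h])
      then have "h (diameter B) \<le> 8 * L * (1 / 2 ^ (k + 3))"
        using order_trans[OF _ k0(1)[OF k(1)], of "2 ^ k * h (diameter B)"]
        by (simp add: power_add field_simps)
      ultimately show ?thesis
        using n(1) by blast
    qed
    then obtain k n where kn: "\<And>B. B \<in> \<B> \<Longrightarrow> n B \<in> level (k B)"
        "\<And>B. B \<in> \<B> \<Longrightarrow> cantor_interval s a (n B) \<subseteq> B"
        "\<And>B. B \<in> \<B> \<Longrightarrow> h (diameter B) \<le> 8 * L * (1 / 2 ^ k B)"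
      by metis
    have "(\<Sum>B\<in>\<B>. ennreal (h (diameter B))) \<le> (\<Sum>B\<in>\<B>. ennreal (8 * L) * ennreal (1 / 2 ^ k B))"
    proof (rule sum_mono)
      fix B assume "B \<in> \<B>"
      then have "ennreal (h (diameter B)) \<le> ennreal (8 * L * (1 / 2 ^ k B))"
        by (intro ennreal_leI kn(3))
      then show "ennreal (h (diameter B)) \<le> ennreal (8 * L) * ennreal (1 / 2 ^ k B)"
        using \<open>0 \<le> L\<close> by (subst ennreal_mult[symmetric]) auto
    qed
    also have "\<dots> \<le> ennreal (8 * L) * 1"
      unfolding sum_distrib_left[symmetric]
    proof (intro mult_left_mono packing_weight_le_1)
      fix B B' assume "B \<in> \<B>" "B' \<in> \<B>" "B \<noteq> B'"
      then show "cantor_interval s a (n B) \<inter> cantor_interval s a (n B') = {}"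
        using \<B>(2) kn(2) unfolding pairwise_def disjnt_def by blast
    qed (use \<B>(1) kn(1) in auto)
    finally show "(\<Sum>B\<in>\<B>. ennreal (h (diameter B))) \<le> ennreal (8 * L)"
      by simp
  qed
  finally show ?thesis .
qed

text \<open>
  Points chosen from the intervals of level \<open>k\<close> whose indices have a fixed parity are more than
  \<open>mean_length a (Suc k)\<close> apart.
\<close>

lemma packing_premeasure_ge_meeting:
  assumes "0 < L" and freq: "\<exists>\<^sub>F k in sequentially. L \<le> 2 ^ k * h (mean_length a k)"
    and m: "0 \<le> m" "\<And>k. m \<le> card (meeting F k) / 2 ^ k"
  shows "ennreal (m * L / 4) \<le> packing_premeasure h F"
  unfolding packing_premeasure_eq_INF
proof (rule INF_greatest)
  fix \<delta> :: real assume "\<delta> \<in> {0<..}"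
  then have "\<forall>\<^sub>F k in sequentially. mean_length a k < \<delta> \<and> 1 \<le> k"
    using mean_length_eventually_less eventually_ge_at_top by (intro eventually_conj) auto
  from frequently_ex[OF frequently_eventually_frequently[OF freq this]]
  obtain k0 where k0: "L \<le> 2 ^ k0 * h (mean_length a k0)" "mean_length a k0 < \<delta>" "1 \<le> k0"
    by auto
  \<comment> \<open>Points of level \<open>k\<close> are kept \<open>mean_length a (Suc k)\<close>
    apart, so the good index \<open>k0\<close> has to be k + 1.\<close>
  define k where "k = k0 - 1"
  define d where "d = mean_length a (Suc k)"
  have k0_eq: "k0 = Suc k"
    using k0(3) by (simp add: k_def)
  have d: "L \<le> 2 ^ Suc k * h d" "0 < d" "d < \<delta>"
    using k0(1,2) mean_length_pos by (auto simp: k0_eq d_def)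
  define M where "M p = {n \<in> meeting F k. even n = p}" for p
  have "card (meeting F k) = card (M True) + card (M False)"
    unfolding M_def by (subst card_Un_disjoint[symmetric]) (auto intro: arg_cong[where f = card])
  then obtain p where p: "card (meeting F k) \<le> 2 * card (M p)"
    by (cases "card (M True) \<le> card (M False)") (auto intro: that[of True] that[of False])
  have M: "n \<in> level k" "cantor_interval s a n \<inter> F \<noteq> {}" "even n = p" if "n \<in> M p" for n
    using that by (auto simp: M_def meeting_def)
  have "finite (M p)"
    by (simp add: M_def)
  have "\<exists>y. y \<in> cantor_interval s a n \<inter> F" if "n \<in> M p" for n
    using M(2)[OF that] by blast
  then obtain x where x: "\<And>n. n \<in> M p \<Longrightarrow> x n \<in> cantor_interval s a n \<inter> F"
    by metis
  have far': "d < x n' - x n" if "n \<in> M p" "n' \<in> M p" "n < n'" for n n'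
  proof -
    \<comment> \<open>Equal parity leaves the whole interval \<open>Suc n\<close> of the same level
      in between, and its length is at least \<open>d\<close>.\<close>
    have "Suc n \<noteq> n'"
      using M(3)[OF that(1)] M(3)[OF that(2)] by auto
    then have lt: "n < Suc n" "Suc n < n'"
      using that(3) by auto
    have lev: "n \<in> level k" "n' \<in> level k" "Suc n \<in> level k"
      using M(1)[OF that(1)] M(1)[OF that(2)] lt by (auto simp: level_def)
    show ?thesis
      using interval_order[OF lt(1) lev(1,3)] interval_order[OF lt(2) lev(3,2)]
        mean_length_le_len[OF lev(3)] x[OF that(1)] x[OF that(2)]
      by (auto simp: cantor_interval_def d_def)
  qed
  have far: "d < dist (x n) (x n')" if "n \<in> M p" "n' \<in> M p" "n \<noteq> n'" for n n'
    using far'[of n n'] far'[of n' n] that d(2) by (cases n n' rule: linorder_cases) (auto simp: dist_real_def)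
  define b where "b n = ball (x n) (d / 2)" for n
  have diam: "diameter (b n) = d" for n
    using d(2) by (simp add: b_def)
  have disj: "disjnt (b n) (b n')" if "n \<in> M p" "n' \<in> M p" "n \<noteq> n'" for n n'
    using far[OF that] unfolding b_def disjnt_def by (intro disjoint_ballI) simp
  have "x n \<in> b n" for n
    using d(2) by (simp add: b_def)
  then have inj: "inj_on b (M p)"
    using disj by (force intro!: inj_onI simp: disjnt_def)
  have "is_packing \<delta> F (b ` M p)"
    unfolding is_packing_def
  proof (intro conjI ballI)
    show "disjoint (b ` M p)"
      using disj by (auto simp: pairwise_def)
    fix B assume "B \<in> b ` M p"
    then obtain n where n: "n \<in> M p" "B = b n"
      by blast
    then show "\<exists>y\<in>F. \<exists>\<rho>>0. B = ball y \<rho>"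
      using x d(2) by (auto simp: b_def intro!: bexI[of _ "x n"] exI[of _ "d / 2"])
    show "diameter B < \<delta>"
      using n(2) diam d(3) by simp
  qed
  then have "(\<Sum>B\<in>b ` M p. ennreal (h (diameter B))) \<le> packing_pre h \<delta> F"
    unfolding packing_pre_def using \<open>finite (M p)\<close> by (intro SUP_upper) simp
  moreover have "ennreal (m * L / 4) \<le> (\<Sum>B\<in>b ` M p. ennreal (h (diameter B)))"
  proof -
    \<comment> \<open>The larger parity class gives at least m 2^k / 2 balls, each of weight at
      least L / 2^(k+1).\<close>
    have "m * L / 4 \<le> (2 * card (M p) / 2 ^ k) * L / 4"
      using m(2)[of k] p \<open>0 < L\<close>
      by (intro divide_right_mono mult_right_mono order_trans[OF m(2)[of k]]) (auto simp flip: of_nat_mult)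
    also have "\<dots> = card (M p) * (L / 2 ^ Suc k)"
      by simp
    also have "\<dots> \<le> card (M p) * h d"
      using d(1) by (intro mult_left_mono) (auto simp: field_simps)
    finally have "ennreal (m * L / 4) \<le> ennreal (card (M p) * h d)"
      by (rule ennreal_leI)
    also have "\<dots> = (\<Sum>B\<in>b ` M p. ennreal (h (diameter B)))"
      using inj diam by (simp add: sum.reindex ennreal_mult' ennreal_of_nat_eq_real_of_nat)
    finally show ?thesis .
  qed
  ultimately show "ennreal (m * L / 4) \<le> packing_pre h \<delta> F"
    by simp
qed

lemma packing_measure_cantor_ge:
  assumes "0 < L" and freq: "\<exists>\<^sub>F k in sequentially. L \<le> 2 ^ k * h (mean_length a k)"
  shows "ennreal (L / 4) \<le> packing_measure h (cantor_set s a)"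
  unfolding packing_measure_def
proof (rule INF_greatest)
  fix F :: "nat \<Rightarrow> real set" assume "F \<in> {F. cantor_set s a = (\<Union>i. F i)}"
  then have F: "cantor_set s a = (\<Union>i. F i)"
    by simp
  \<comment> \<open>The infimum over all levels works both ways: it lies below the proportion at the
    good levels, which bounds the premeasure, and it is nearly attained at some level, which yields
    the cover.\<close>
  define m where "m i = (INF k. card (meeting (F i) k) / 2 ^ k)" for i
  have bdd: "bdd_below (range (\<lambda>k. card (meeting (F i) k) / 2 ^ k))" for i
    by (rule bdd_belowI[of _ 0]) auto
  have m: "0 \<le> m i" "m i \<le> card (meeting (F i) k) / 2 ^ k" for i k
    unfolding m_def by (auto intro: cINF_greatest cINF_lower[OF bdd])
  have premeasure: "ennreal (m i) * ennreal (L / 4) \<le> packing_premeasure h (F i)" for i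
    using packing_premeasure_ge_meeting[OF assms m] m(1)[of i] \<open>0 < L\<close>
    by (simp add: ennreal_mult[symmetric])
  show "ennreal (L / 4) \<le> (\<Sum>i. packing_premeasure h (F i))"
  proof (rule ennreal_le_epsilon)
    fix e :: real assume "0 < e"
    \<comment> \<open>The total excess \<epsilon> is multiplied by L/4 at the end, which makes it
      \<open>e\<close>.\<close>
    define \<epsilon> where "\<epsilon> = 4 * e / L"
    have "0 < \<epsilon>"
      using \<open>0 < e\<close> \<open>0 < L\<close> by (simp add: \<epsilon>_def)
    have "\<exists>k. card (meeting (F i) k) / 2 ^ k < m i + \<epsilon> * (1/2) ^ Suc i" for i
      using \<open>0 < \<epsilon>\<close> cINF_less_iff[OF _ bdd, of i "m i + \<epsilon> * (1/2) ^ Suc i"]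
      by (simp add: m_def[symmetric] del: power_Suc)
    then obtain k where k: "\<And>i. card (meeting (F i) (k i)) / 2 ^ k i < m i + \<epsilon> * (1/2) ^ Suc i"
      by metis
    have "cantor_set s a \<subseteq> (\<Union>i. \<Union>n\<in>meeting (F i) (k i). cantor_interval s a n)"
      by (rule meeting_cover) (simp add: F)
    then have "1 \<le> (\<Sum>i. ennreal (card (meeting (F i) (k i)) / 2 ^ k i))"
      by (rule cover_weight_ge_1) (auto simp: meeting_def)
    also have "\<dots> \<le> (\<Sum>i. ennreal (m i + \<epsilon> * (1/2) ^ Suc i))"
      using k by (intro suminf_le ennreal_leI) (auto intro: less_imp_le)
    also have "\<dots> = (\<Sum>i. ennreal (m i)) + ennreal \<epsilon>"
      using \<open>0 < \<epsilon>\<close> m(1) by (intro suminf_add_half_powers_ennreal) auto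
    finally have "1 * ennreal (L / 4) \<le> ((\<Sum>i. ennreal (m i)) + ennreal \<epsilon>) * ennreal (L / 4)"
      by (rule mult_right_mono) simp
    also have "\<dots> = (\<Sum>i. ennreal (m i) * ennreal (L / 4)) + ennreal e"
      using \<open>0 < L\<close> \<open>0 < \<epsilon>\<close>
      by (simp add: distrib_right ennreal_suminf_multc ennreal_mult[symmetric]) (simp add: \<epsilon>_def)
    also have "\<dots> \<le> (\<Sum>i. packing_premeasure h (F i)) + ennreal e"
      using premeasure by (intro add_right_mono suminf_le) auto
    finally show "ennreal (L / 4) \<le> (\<Sum>i. packing_premeasure h (F i)) + ennreal e"
      by simp
  qed
qed

end

subsection \<open>Comparison of two sequences\<close>

context cantor
begin

context
  fixes A :: real and h :: "real \<Rightarrow> real"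
  assumes h: "(A, h) \<in> dimension_functions"
begin

text \<open>Here and in the next three criteria \<open>L\<close> ranges over all positive reals,
  which absorbs the constants 2, 8, 8 and 4 of the estimates. If the condition fails for one
  \<open>L\<close>, the opposite estimate applies with that \<open>L\<close>.\<close>

lemma hausdorff_measure_cantor_eq_0_iff:
  "hausdorff_measure h (cantor_set s a) = 0 \<longleftrightarrow>
     (\<forall>L>0. \<exists>\<^sub>F k in sequentially. 2 ^ k * h (mean_length a k) \<le> L)"
proof (intro iffI allI impI)
  fix L :: real assume 0: "hausdorff_measure h (cantor_set s a) = 0" and "0 < L"
  show "\<exists>\<^sub>F k in sequentially. 2 ^ k * h (mean_length a k) \<le> L"
    unfolding frequently_def
  proof
    assume "\<forall>\<^sub>F k in sequentially. \<not> 2 ^ k * h (mean_length a k) \<le> L"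
    then have "\<forall>\<^sub>F k in sequentially. L \<le> 2 ^ k * h (mean_length a k)"
      by eventually_elim simp
    then show False
      using hausdorff_measure_cantor_ge[OF h \<open>0 < L\<close>] 0 \<open>0 < L\<close> by simp
  qed
next
  assume freq: "\<forall>L>0. \<exists>\<^sub>F k in sequentially. 2 ^ k * h (mean_length a k) \<le> L"
  have "hausdorff_measure h (cantor_set s a) \<le> 0 + ennreal e" if "0 < e" for e
    using hausdorff_measure_cantor_le[OF h _ freq[rule_format, of "e / 2"]] that by simp
  then show "hausdorff_measure h (cantor_set s a) = 0"
    using ennreal_le_epsilon[of 0 "hausdorff_measure h (cantor_set s a)"] by simp
qed

lemma hausdorff_measure_cantor_eq_top_iff:
  "hausdorff_measure h (cantor_set s a) = \<infinity> \<longleftrightarrow>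
     (\<forall>L>0. \<forall>\<^sub>F k in sequentially. L \<le> 2 ^ k * h (mean_length a k))"
proof (intro iffI allI impI)
  fix L :: real assume top: "hausdorff_measure h (cantor_set s a) = \<infinity>" and "0 < L"
  show "\<forall>\<^sub>F k in sequentially. L \<le> 2 ^ k * h (mean_length a k)"
  proof (rule ccontr)
    assume "\<not> ?thesis"
    then have "\<exists>\<^sub>F k in sequentially. 2 ^ k * h (mean_length a k) \<le> L"
      unfolding not_eventually by (rule frequently_elim1) simp
    then show False
      using hausdorff_measure_cantor_le[OF h, of L] top \<open>0 < L\<close> by (simp add: top_unique)
  qed
next
  assume ev: "\<forall>L>0. \<forall>\<^sub>F k in sequentially. L \<le> 2 ^ k * h (mean_length a k)"
  show "hausdorff_measure h (cantor_set s a) = \<infinity>"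
  proof (rule ccontr)
    assume "\<not> ?thesis"
    then obtain r where r: "0 \<le> r" "hausdorff_measure h (cantor_set s a) = ennreal r"
      by (cases "hausdorff_measure h (cantor_set s a)") auto
    then show False
      using hausdorff_measure_cantor_ge[OF h, of "8 * (r + 1)"] ev by simp
  qed
qed

lemma packing_measure_cantor_eq_0_iff:
  "packing_measure h (cantor_set s a) = 0 \<longleftrightarrow>
     (\<forall>L>0. \<forall>\<^sub>F k in sequentially. 2 ^ k * h (mean_length a k) \<le> L)"
proof (intro iffI allI impI)
  fix L :: real assume 0: "packing_measure h (cantor_set s a) = 0" and "0 < L"
  show "\<forall>\<^sub>F k in sequentially. 2 ^ k * h (mean_length a k) \<le> L"
  proof (rule ccontr)
    assume "\<not> ?thesis"
    then have "\<exists>\<^sub>F k in sequentially. L \<le> 2 ^ k * h (mean_length a k)"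
      unfolding not_eventually by (rule frequently_elim1) simp
    then show False
      using packing_measure_cantor_ge[OF \<open>0 < L\<close>, of h] 0 \<open>0 < L\<close> by simp
  qed
next
  assume ev: "\<forall>L>0. \<forall>\<^sub>F k in sequentially. 2 ^ k * h (mean_length a k) \<le> L"
  have "packing_measure h (cantor_set s a) \<le> 0 + ennreal e" if "0 < e" for e
    using packing_premeasure_cantor_le[OF h _ ev[rule_format, of "e / 8"]] that
    by (auto intro: order_trans[OF packing_measure_le_premeasure])
  then show "packing_measure h (cantor_set s a) = 0"
    using ennreal_le_epsilon[of 0 "packing_measure h (cantor_set s a)"] by simp
qed

lemma packing_measure_cantor_eq_top_iff:
  "packing_measure h (cantor_set s a) = \<infinity> \<longleftrightarrow>
     (\<forall>L>0. \<exists>\<^sub>F k in sequentially. L \<le> 2 ^ k * h (mean_length a k))"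
proof (intro iffI allI impI)
  fix L :: real assume top: "packing_measure h (cantor_set s a) = \<infinity>" and "0 < L"
  show "\<exists>\<^sub>F k in sequentially. L \<le> 2 ^ k * h (mean_length a k)"
    unfolding frequently_def
  proof
    assume "\<forall>\<^sub>F k in sequentially. \<not> L \<le> 2 ^ k * h (mean_length a k)"
    then have "\<forall>\<^sub>F k in sequentially. 2 ^ k * h (mean_length a k) \<le> L"
      by eventually_elim simp
    then have "packing_measure h (cantor_set s a) \<le> ennreal (8 * L)"
      using packing_premeasure_cantor_le[OF h, of L] \<open>0 < L\<close>
      by (auto intro: order_trans[OF packing_measure_le_premeasure])
    then show False
      using top by (simp add: top_unique)
  qed
next
  assume freq: "\<forall>L>0. \<exists>\<^sub>F k in sequentially. L \<le> 2 ^ k * h (mean_length a k)"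
  show "packing_measure h (cantor_set s a) = \<infinity>"
  proof (rule ccontr)
    assume "\<not> ?thesis"
    then obtain r where r: "0 \<le> r" "packing_measure h (cantor_set s a) = ennreal r"
      by (cases "packing_measure h (cantor_set s a)") auto
    then show False
      using packing_measure_cantor_ge[of "4 * (r + 1)" h] freq by simp
  qed
qed

end

end

text \<open>The defining bounds are sampled at n = 2^k, where the argument tail a n / n is
  \<open>mean_length a k\<close>.\<close>

lemma (in gap_seq) associated_imp_bounded:
  assumes "associated a (A, h)"
  obtains c\<^sub>1 c\<^sub>2 where "0 < c\<^sub>1" "0 < c\<^sub>2"
    "\<forall>\<^sub>F k in sequentially. c\<^sub>1 \<le> 2 ^ k * h (mean_length a k) \<and> 2 ^ k * h (mean_length a k) \<le> c\<^sub>2 \<and>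
      mean_length a k < A"
proof -
  obtain c\<^sub>1 c\<^sub>2 where c: "0 < c\<^sub>1" "0 < c\<^sub>2" "\<And>n. 1 \<le> n \<Longrightarrow> tail a n / real n \<le> A \<Longrightarrow>
      c\<^sub>1 \<le> h (tail a n / real n) / (1 / real n) \<and> h (tail a n / real n) / (1 / real n) \<le> c\<^sub>2"
    using assms unfolding associated_def equivalent_seq_on_def by auto
  have "0 < A"
    using assms by (simp add: associated_def inc_cont_fun_def)
  have "\<forall>\<^sub>F k in sequentially. c\<^sub>1 \<le> 2 ^ k * h (mean_length a k) \<and> 2 ^ k * h (mean_length a k) \<le> c\<^sub>2 \<and>
      mean_length a k < A"
    using mean_length_eventually_less[OF \<open>0 < A\<close>]
  proof eventually_elim
    case (elim k)
    then show ?case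
      using c(3)[of "2 ^ k"] by (simp add: mean_length_def mult.commute)
  qed
  with c(1,2) show thesis
    by (rule that)
qed

section \<open>Domination of averages up to an index shift\<close>

definition dyadic_dominated :: "(nat \<Rightarrow> real) \<Rightarrow> (nat \<Rightarrow> real) \<Rightarrow> bool" where
  "dyadic_dominated b a \<longleftrightarrow> (\<exists>J. \<forall>k. mean_length b (k + J) \<le> mean_length a k)"

context
  fixes a b :: "nat \<Rightarrow> real"
  assumes a: "gap_sequence a" and b: "gap_sequence b"
begin

interpretation a: gap_seq a
  using a by unfold_locales

interpretation b: gap_seq b
  using b by unfold_locales

text \<open>A larger shift repairs the finitely many exceptions: once
  \<open>mean_length b J' \<le> mean_length a K\<close>, monotonicity of both sequences settles
  every \<open>k\<close> below \<open>K\<close>.\<close>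

lemma dyadic_dominatedI_eventually:
  assumes "\<forall>\<^sub>F k in sequentially. mean_length b (k + J) \<le> mean_length a k"
  shows "dyadic_dominated b a"
proof -
  obtain K where K: "\<And>k. K \<le> k \<Longrightarrow> mean_length b (k + J) \<le> mean_length a k"
    using assms by (auto simp: eventually_sequentially)
  obtain J' where J': "J \<le> J'" "mean_length b J' \<le> mean_length a K"
    using eventually_conj[OF eventually_ge_at_top[of J] b.mean_length_eventually_less[OF a.mean_length_pos[of K]]]
    by (auto simp: eventually_sequentially intro: less_imp_le)
  have "mean_length b (k + J') \<le> mean_length a k" for k
  proof (cases "K \<le> k")
    case True
    then show ?thesis
      using K[of k] b.mean_length_antimono[of "k + J" "k + J'"] J'(1) by simp
  next
    case False
    then show ?thesis
      using J'(2) b.mean_length_antimono[of J' "k + J'"] a.mean_length_antimono[of k K] by simp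
  qed
  then show ?thesis
    by (auto simp: dyadic_dominated_def)
qed

text \<open>The right side is one half of weak tail-equivalence. Divided by \<open>n\<close>, it
  compares the quotients tail b m / m at m = jn and tail a n / n; these decrease, so powers of two
  suffice.\<close>

lemma dyadic_dominated_iff_tail:
  "dyadic_dominated b a \<longleftrightarrow> (\<exists>j::nat. 1 \<le> j \<and> (\<forall>n\<ge>1. tail b (j * n) / real j \<le> tail a n))"
proof
  assume "dyadic_dominated b a"
  then obtain J where J: "\<And>k. mean_length b (k + J) \<le> mean_length a k"
    by (auto simp: dyadic_dominated_def)
  \<comment> \<open>The shift is applied at level k + 1, since 2^(k+1) is the power of two above
    \<open>n\<close>; this costs one more factor 2.\<close>
  define j :: nat where "j = 2 ^ Suc J"
  have "tail b (j * n) / real j \<le> tail a n" if n: "1 \<le> n" for n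
  proof -
    obtain k where k: "2 ^ k \<le> n" "n < 2 ^ Suc k"
      using ex_power_ivl1[of 2 n] n by auto
    have "2 ^ (Suc k + J) = 2 ^ k * j"
      by (simp add: j_def power_add)
    also have "\<dots> \<le> n * j"
      using k(1) by simp
    finally have "tail b (j * n) / real (j * n) \<le> mean_length b (Suc k + J)"
      using b.tail_div_antimono[of "2 ^ (Suc k + J)" "j * n"] by (simp add: mean_length_def mult.commute)
    also have "\<dots> \<le> mean_length a (Suc k)"
      by (rule J)
    also have "\<dots> \<le> tail a n / real n"
      using a.tail_div_antimono[of n "2 ^ Suc k"] n k(2) by (simp add: mean_length_def)
    finally show ?thesis
      using n by (simp add: j_def field_simps)
  qed
  moreover have "1 \<le> j"
    by (simp add: j_def)
  ultimately show "\<exists>j::nat. 1 \<le> j \<and> (\<forall>n\<ge>1. tail b (j * n) / real j \<le> tail a n)"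
    by blast
next
  assume "\<exists>j::nat. 1 \<le> j \<and> (\<forall>n\<ge>1. tail b (j * n) / real j \<le> tail a n)"
  then obtain j :: nat where j: "1 \<le> j" "\<And>n. 1 \<le> n \<Longrightarrow> tail b (j * n) / real j \<le> tail a n"
    by blast
  \<comment> \<open>The crude shift by \<open>j\<close> works because j \<le> 2^j.\<close>
  have "mean_length b (k + j) \<le> mean_length a k" for k
  proof -
    have "j * 2 ^ k \<le> 2 ^ (k + j)"
      using less_imp_le[OF less_exp[of j]] by (simp add: power_add)
    then have "mean_length b (k + j) \<le> tail b (j * 2 ^ k) / real (j * 2 ^ k)"
      using b.tail_div_antimono[of "j * 2 ^ k" "2 ^ (k + j)"] j(1) by (simp add: mean_length_def)
    also have "\<dots> = (tail b (j * 2 ^ k) / real j) / 2 ^ k"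
      by simp
    also have "\<dots> \<le> tail a (2 ^ k) / 2 ^ k"
      using j(2)[of "2 ^ k"] by (intro divide_right_mono) auto
    finally show ?thesis
      by (simp add: mean_length_def)
  qed
  then show "dyadic_dominated b a"
    by (auto simp: dyadic_dominated_def)
qed

text \<open>A shift by \<open>J\<close> lowers the upper bound \<open>c\<^sub>2 / 2 ^ k\<close>
  along \<open>b\<close> by the factor 2^J, below \<open>c\<^sub>1 / 2 ^ k\<close> for large
  \<open>J\<close>. Strict monotonicity then carries the order of the values of \<open>h\<close>
  over to the arguments.\<close>

lemma dyadic_dominatedI_mono:
  assumes h: "inc_cont_fun (A, h)" and c: "0 < c\<^sub>1"
    and ev: "\<forall>\<^sub>F k in sequentially. c\<^sub>1 \<le> 2 ^ k * h (mean_length a k)"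
      "\<forall>\<^sub>F k in sequentially. 2 ^ k * h (mean_length b k) \<le> c\<^sub>2"
  shows "dyadic_dominated b a"
proof -
  have A: "0 < A"
    using h by (simp add: inc_cont_fun_def)
  obtain J where J: "c\<^sub>2 / c\<^sub>1 < 2 ^ J"
    using real_arch_pow[of 2] by auto
  show ?thesis
  proof (rule dyadic_dominatedI_eventually)
    show "\<forall>\<^sub>F k in sequentially. mean_length b (k + J) \<le> mean_length a k"
      using ev(1) sequentially_offset[OF ev(2), of J] a.mean_length_eventually_less[OF A]
        sequentially_offset[OF b.mean_length_eventually_less[OF A], of J]
    proof eventually_elim
      case (elim k)
      have "2 ^ k * (2 ^ J * h (mean_length b (k + J))) \<le> c\<^sub>2"
        using elim(2) by (simp add: power_add mult.assoc)
      also have "\<dots> < 2 ^ J * c\<^sub>1"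
        using J c by (simp add: field_simps)
      also have "\<dots> \<le> 2 ^ J * (2 ^ k * h (mean_length a k))"
        using elim(1) by (intro mult_left_mono) auto
      finally have "h (mean_length b (k + J)) < h (mean_length a k)"
        by (simp add: mult.left_commute)
      moreover have "h (mean_length a k) < h (mean_length b (k + J))"
        if "mean_length a k < mean_length b (k + J)"
        using h that elim(3,4) a.mean_length_pos b.mean_length_pos
        by (auto simp: inc_cont_fun_def strict_mono_on_def)
      ultimately show ?case
        by fastforce
    qed
  qed
qed

end

text \<open>\<open>f\<close> tests both sequences: association bounds it below along the averages of
  \<open>a\<close>, and domination by \<open>g\<close> bounds it above along those of
  \<open>b\<close>. The associated pair is arbitrary, as the existential condition (1)
  requires.\<close>

lemma dyadic_dominated_if_associated:
  assumes a: "gap_sequence a" and b: "gap_sequence b"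
    and f: "associated a f" and g: "associated b g" and fg: "dominated f g"
  shows "dyadic_dominated b a"
proof -
  obtain A f' where f_eq: "f = (A, f')"
    by (cases f)
  obtain B g' where g_eq: "g = (B, g')"
    by (cases g)
  note eq = f_eq g_eq
  interpret a: gap_seq a
    using a by unfold_locales
  interpret b: gap_seq b
    using b by unfold_locales
  obtain c\<^sub>1 c\<^sub>2 where c: "0 < c\<^sub>1" "\<forall>\<^sub>F k in sequentially. c\<^sub>1 \<le> 2 ^ k * f' (mean_length a k) \<and>
      2 ^ k * f' (mean_length a k) \<le> c\<^sub>2 \<and> mean_length a k < A"
    using f unfolding eq by (rule a.associated_imp_bounded)
  obtain d\<^sub>1 d\<^sub>2 where d: "0 < d\<^sub>1" "\<forall>\<^sub>F k in sequentially. d\<^sub>1 \<le> 2 ^ k * g' (mean_length b k) \<and>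
      2 ^ k * g' (mean_length b k) \<le> d\<^sub>2 \<and> mean_length b k < B"
    using g unfolding eq by (rule b.associated_imp_bounded)
  obtain C where C: "0 < C" "\<And>x. x \<in> {0<..A} \<Longrightarrow> x \<in> {0<..B} \<Longrightarrow> f' x \<le> C * g' x"
    using fg unfolding dominated_def eq by auto
  have inc: "inc_cont_fun (A, f')"
    using f by (simp add: associated_def eq)
  then have "0 < A"
    by (simp add: inc_cont_fun_def)
  show ?thesis
  proof (rule dyadic_dominatedI_mono[OF a b inc c(1)])
    show "\<forall>\<^sub>F k in sequentially. c\<^sub>1 \<le> 2 ^ k * f' (mean_length a k)"
      using c(2) by eventually_elim simp
    show "\<forall>\<^sub>F k in sequentially. 2 ^ k * f' (mean_length b k) \<le> C * d\<^sub>2"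
      using d(2) b.mean_length_eventually_less[OF \<open>0 < A\<close>]
    proof eventually_elim
      case (elim k)
      have "2 ^ k * f' (mean_length b k) \<le> 2 ^ k * (C * g' (mean_length b k))"
        using elim b.mean_length_pos[of k] by (intro mult_left_mono C(2)) auto
      also have "\<dots> \<le> C * d\<^sub>2"
        using elim C(1) by (simp add: mult.left_commute)
      finally show ?case .
    qed
  qed
qed

text \<open>A fixed shift and a fixed factor 2^J affect none of the four criteria. Each implication
  goes one way; domination in both directions will turn them into equivalences.\<close>

lemma measures_if_dyadic_dominated:
  assumes a: "gap_sequence a" and b: "gap_sequence b" and dom: "dyadic_dominated b a"
    and h: "(A, h) \<in> dimension_functions"
  shows "hausdorff_measure h (cantor_set s a) = 0 \<Longrightarrow> hausdorff_measure h (cantor_set t b) = 0"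
    and "hausdorff_measure h (cantor_set t b) = \<infinity> \<Longrightarrow> hausdorff_measure h (cantor_set s a) = \<infinity>"
    and "packing_measure h (cantor_set s a) = 0 \<Longrightarrow> packing_measure h (cantor_set t b) = 0"
    and "packing_measure h (cantor_set t b) = \<infinity> \<Longrightarrow> packing_measure h (cantor_set s a) = \<infinity>"
proof -
  interpret a: cantor a s
    using a by unfold_locales
  interpret b: cantor b t
    using b by unfold_locales
  define p where "p k = 2 ^ k * h (mean_length a k)" for k
  define q where "q k = 2 ^ k * h (mean_length b k)" for k
  obtain J where J: "\<And>k. mean_length b (k + J) \<le> mean_length a k"
    using dom by (auto simp: dyadic_dominated_def)
  have qp: "\<forall>\<^sub>F k in sequentially. q (k + J) \<le> 2 ^ J * p k"
    using a.mean_length_eventually_less[OF dimension_function_domain[OF h]]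
  proof eventually_elim
    case (elim k)
    then have "h (mean_length b (k + J)) \<le> h (mean_length a k)"
      using J by (intro dimension_function_mono[OF h]) auto
    then show ?case
      by (simp add: p_def q_def power_add)
  qed
  have shift: "frequently P sequentially" if "\<exists>\<^sub>F k in sequentially. P (k + J)" for P
    using that unfolding frequently_def by (auto dest: sequentially_offset[of _ J])
  have shift': "eventually P sequentially" if "\<forall>\<^sub>F k in sequentially. P (k + J)" for P
    using that by (simp add: eventually_sequentially_seg)
  have unshift: "\<exists>\<^sub>F k in sequentially. P (k + J)" if "frequently P sequentially" for P
    using that unfolding frequently_def by (simp add: eventually_sequentially_seg[of "\<lambda>k. \<not> P k"])
  have upper: "q (k + J) \<le> L" if "q (k + J) \<le> 2 ^ J * p k" "p k \<le> L / 2 ^ J" for k L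
    using that by (simp add: field_simps)
  have lower: "L \<le> p k" if "q (k + J) \<le> 2 ^ J * p k" "2 ^ J * L \<le> q (k + J)" for k L
    using order_trans[OF that(2,1)] by simp
  show "hausdorff_measure h (cantor_set s a) = 0 \<Longrightarrow> hausdorff_measure h (cantor_set t b) = 0"
    unfolding a.hausdorff_measure_cantor_eq_0_iff[OF h] b.hausdorff_measure_cantor_eq_0_iff[OF h]
      p_def[symmetric] q_def[symmetric]
  proof (intro allI impI, rule shift)
    fix L :: real assume "\<forall>L>0. \<exists>\<^sub>F k in sequentially. p k \<le> L" "0 < L"
    then have "\<exists>\<^sub>F k in sequentially. p k \<le> L / 2 ^ J"
      by simp
    from frequently_eventually_frequently[OF this qp]
    show "\<exists>\<^sub>F k in sequentially. q (k + J) \<le> L"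
      by (rule frequently_elim1) (use upper in blast)
  qed
  show "hausdorff_measure h (cantor_set t b) = \<infinity> \<Longrightarrow> hausdorff_measure h (cantor_set s a) = \<infinity>"
    unfolding a.hausdorff_measure_cantor_eq_top_iff[OF h] b.hausdorff_measure_cantor_eq_top_iff[OF h]
      p_def[symmetric] q_def[symmetric]
  proof (intro allI impI)
    fix L :: real assume "\<forall>L>0. \<forall>\<^sub>F k in sequentially. L \<le> q k" "0 < L"
    then have "\<forall>\<^sub>F k in sequentially. 2 ^ J * L \<le> q k"
      by simp
    from sequentially_offset[OF this, of J] qp
    show "\<forall>\<^sub>F k in sequentially. L \<le> p k"
      by eventually_elim (use lower in blast)
  qed
  show "packing_measure h (cantor_set s a) = 0 \<Longrightarrow> packing_measure h (cantor_set t b) = 0"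
    unfolding a.packing_measure_cantor_eq_0_iff[OF h] b.packing_measure_cantor_eq_0_iff[OF h]
      p_def[symmetric] q_def[symmetric]
  proof (intro allI impI, rule shift')
    fix L :: real assume "\<forall>L>0. \<forall>\<^sub>F k in sequentially. p k \<le> L" "0 < L"
    then have "\<forall>\<^sub>F k in sequentially. p k \<le> L / 2 ^ J"
      by simp
    from this qp show "\<forall>\<^sub>F k in sequentially. q (k + J) \<le> L"
      by eventually_elim (use upper in blast)
  qed
  show "packing_measure h (cantor_set t b) = \<infinity> \<Longrightarrow> packing_measure h (cantor_set s a) = \<infinity>"
    unfolding a.packing_measure_cantor_eq_top_iff[OF h] b.packing_measure_cantor_eq_top_iff[OF h]
      p_def[symmetric] q_def[symmetric]
  proof (intro allI impI)
    fix L :: real assume "\<forall>L>0. \<exists>\<^sub>F k in sequentially. L \<le> q k" "0 < L"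
    then have "\<exists>\<^sub>F k in sequentially. 2 ^ J * L \<le> q (k + J)"
      by (intro unshift) simp
    from frequently_eventually_frequently[OF this qp]
    show "\<exists>\<^sub>F k in sequentially. L \<le> p k"
      by (rule frequently_elim1) (use lower in blast)
  qed
qed

subsection \<open>The associated dimension function\<close>

context gap_seq
begin

text \<open>Clamping makes each ramp continuous, monotone and bounded by 1. The interpolant is then
  continuous as a uniformly convergent series and monotone term by term, with no case split at the
  breakpoints.\<close>

definition ramp :: "nat \<Rightarrow> real \<Rightarrow> real" where
  "ramp k x = max 0 (min 1 ((x - mean_length a (Suc k)) / (mean_length a k - mean_length a (Suc k))))"

text \<open>
  Linear between the values \<open>1 / 2 ^ k\<close> at \<open>mean_length a k\<close>: at such an argument the ramps below \<open>k\<close>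
  vanish and the others are \<open>1\<close>.
\<close>

definition interpolant :: "real \<Rightarrow> real" where
  "interpolant x = (\<Sum>k. (1/2) ^ Suc k * ramp k x)"

definition assoc_fun :: "real \<Rightarrow> real" where
  "assoc_fun x = (if x \<in> {0<..mean_length a 0} then interpolant x else 0)"

lemma ramp_bounds: "0 \<le> ramp k x" "ramp k x \<le> 1"
  by (auto simp: ramp_def)

lemma ramp_eq_0: "x \<le> mean_length a (Suc k) \<Longrightarrow> ramp k x = 0"
  using divide_nonpos_pos[of "x - mean_length a (Suc k)" "mean_length a k - mean_length a (Suc k)"]
    mean_length_less[of k] by (simp add: ramp_def)

lemma ramp_eq_1: "mean_length a k \<le> x \<Longrightarrow> ramp k x = 1"
  using mean_length_less[of k] by (simp add: ramp_def)

lemma ramp_mono: "x \<le> y \<Longrightarrow> ramp k x \<le> ramp k y"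
  unfolding ramp_def using mean_length_less[of k]
  by (intro max.mono min.mono divide_right_mono) auto

lemma ramp_strict_mono:
  assumes "x < y" "mean_length a (Suc k) < y" "y \<le> mean_length a k"
  shows "ramp k x < ramp k y"
proof -
  define d where "d = mean_length a k - mean_length a (Suc k)"
  have d: "0 < d"
    using mean_length_less[of k] by (simp add: d_def)
  have "ramp k y = (y - mean_length a (Suc k)) / d"
    using assms d unfolding ramp_def d_def[symmetric] by (simp add: d_def)
  moreover have "ramp k x \<le> max 0 ((x - mean_length a (Suc k)) / d)"
    unfolding ramp_def d_def[symmetric] by simp
  moreover have "max 0 ((x - mean_length a (Suc k)) / d) < (y - mean_length a (Suc k)) / d"
    using assms d by (simp add: divide_strict_right_mono)
  ultimately show ?thesis
    by linarith
qed

lemma summable_ramp: "summable (\<lambda>k. (1/2) ^ Suc k * ramp k x)"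
proof (rule summable_comparison_test')
  show "summable (\<lambda>k. (1/2::real) ^ Suc k)"
    using power_half_series by (rule sums_summable)
  show "norm ((1/2) ^ Suc k * ramp k x) \<le> (1/2) ^ Suc k" for k
    using ramp_bounds[of k x] by (simp add: abs_mult)
qed

lemma continuous_interpolant: "continuous_on UNIV interpolant"
proof (rule uniform_limit_theorem)
  show "uniform_limit UNIV (\<lambda>n x. \<Sum>k<n. (1/2) ^ Suc k * ramp k x) interpolant sequentially"
    unfolding interpolant_def
  proof (rule Weierstrass_m_test)
    show "summable (\<lambda>k. (1/2::real) ^ Suc k)"
      using power_half_series by (rule sums_summable)
    show "norm ((1/2) ^ Suc k * ramp k x) \<le> (1/2) ^ Suc k" for k x
      using ramp_bounds[of k x] by (simp add: abs_mult)
  qed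
  show "\<forall>\<^sub>F n in sequentially. continuous_on UNIV (\<lambda>x. \<Sum>k<n. (1/2) ^ Suc k * ramp k x)"
    unfolding ramp_def using mean_length_less
    by (intro always_eventually allI continuous_intros) (simp add: less_imp_neq[symmetric])
qed simp

lemma interpolant_0: "interpolant 0 = 0"
  using ramp_eq_0[of 0] mean_length_pos by (simp add: interpolant_def less_imp_le)

lemma interpolant_mono: "x \<le> y \<Longrightarrow> interpolant x \<le> interpolant y"
  unfolding interpolant_def
  by (intro suminf_le summable_ramp mult_left_mono ramp_mono) auto

lemma interpolant_mean_length: "interpolant (mean_length a k) = (1/2) ^ k"
proof -
  have "(\<lambda>i. (1/2) ^ k * (1/2) ^ Suc i) sums ((1/2::real) ^ k * 1)"
    by (intro sums_mult power_half_series)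
  moreover have "(1/2) ^ Suc (i + k) * ramp (i + k) (mean_length a k) = (1/2) ^ k * (1/2) ^ Suc i" for i
    using ramp_eq_1[of "i + k" "mean_length a k"] mean_length_antimono[of k "i + k"]
    by (simp add: power_add)
  moreover have "(\<Sum>i<k. (1/2) ^ Suc i * ramp i (mean_length a k)) = 0"
  proof (rule sum.neutral, rule ballI)
    fix i assume "i \<in> {..<k}"
    then have "mean_length a k \<le> mean_length a (Suc i)"
      by (intro mean_length_antimono) simp
    then show "(1/2) ^ Suc i * ramp i (mean_length a k) = 0"
      by (simp add: ramp_eq_0)
  qed
  ultimately show ?thesis
    unfolding interpolant_def
    by (subst suminf_split_initial_segment[OF summable_ramp, of _ k]) (simp add: sums_iff)
qed

lemma interpolant_strict_mono:
  assumes "0 < x" "x < y" "y \<le> mean_length a 0"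
  shows "interpolant x < interpolant y"
proof -
  \<comment> \<open>\<open>y\<close> lies on the rising part of \<open>ramp k\<close>, so this term
    grows strictly while no other term decreases.\<close>
  obtain k where k: "mean_length a (Suc k) < y" "y \<le> mean_length a k"
    using mean_length_bracket[of y 0] assms by auto
  have "0 < (\<Sum>i. (1/2) ^ Suc i * ramp i y - (1/2) ^ Suc i * ramp i x)"
  proof (rule suminf_pos2[where i = k])
    show "summable (\<lambda>i. (1/2) ^ Suc i * ramp i y - (1/2) ^ Suc i * ramp i x)"
      by (intro summable_diff summable_ramp)
    show "0 \<le> (1/2) ^ Suc i * ramp i y - (1/2) ^ Suc i * ramp i x" for i
      using ramp_mono[of x y i] assms(2) by simp
    show "0 < (1/2) ^ Suc k * ramp k y - (1/2) ^ Suc k * ramp k x"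
      using ramp_strict_mono[OF assms(2) k] by simp
  qed
  then show ?thesis
    unfolding interpolant_def by (subst (asm) suminf_diff[OF summable_ramp summable_ramp, symmetric]) simp
qed

lemma assoc_fun_eq: "0 < x \<Longrightarrow> x \<le> mean_length a 0 \<Longrightarrow> assoc_fun x = interpolant x"
  by (simp add: assoc_fun_def)

lemma assoc_fun_mean_length: "assoc_fun (mean_length a k) = 1 / 2 ^ k"
  using mean_length_pos mean_length_antimono[of 0 k]
  by (simp add: assoc_fun_eq interpolant_mean_length power_one_over)

lemma assoc_fun_upper:
  assumes "0 < x" "x \<le> mean_length a k"
  shows "assoc_fun x \<le> 1 / 2 ^ k"
  using assms interpolant_mono[of x "mean_length a k"] mean_length_antimono[of 0 k]
  by (simp add: assoc_fun_eq interpolant_mean_length power_one_over)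

lemma assoc_fun_lower:
  assumes "mean_length a k \<le> x" "x \<le> mean_length a 0"
  shows "1 / 2 ^ k \<le> assoc_fun x"
  using assms interpolant_mono[of "mean_length a k" x] mean_length_pos[of k]
  by (simp add: assoc_fun_eq interpolant_mean_length power_one_over)

lemma inc_cont_fun_assoc_fun: "inc_cont_fun (mean_length a 0, assoc_fun)"
  unfolding inc_cont_fun_def prod.case
proof (intro conjI ballI allI impI)
  show "0 < mean_length a 0"
    by (rule mean_length_pos)
  have "continuous_on {0<..mean_length a 0} interpolant"
    using continuous_interpolant by (rule continuous_on_subset) simp
  then show "continuous_on {0<..mean_length a 0} assoc_fun"
    by (rule continuous_on_eq) (simp add: assoc_fun_eq)
  show "strict_mono_on {0<..mean_length a 0} assoc_fun"
    using interpolant_strict_mono by (auto simp: strict_mono_on_def assoc_fun_eq)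
  fix x
  show "0 < assoc_fun x" if "x \<in> {0<..mean_length a 0}"
    using that interpolant_strict_mono[of "x / 2" x] interpolant_mono[of 0 "x / 2"] interpolant_0
    by (simp add: assoc_fun_eq)
  show "assoc_fun x = 0" if "x \<notin> {0<..mean_length a 0}"
    using that by (auto simp: assoc_fun_def)
qed

lemma doubling_assoc_fun: "doubling (mean_length a 0, assoc_fun)"
  unfolding doubling_def prod.case
proof (intro exI[of _ "1/4"] conjI allI impI)
  fix x assume x: "x \<in> {0<..mean_length a 0} \<and> 2 * x \<in> {0<..mean_length a 0}"
  then obtain k where k: "mean_length a (Suc k) < x" "x \<le> mean_length a k"
    using mean_length_bracket[of x 0] by auto
  \<comment> \<open>From x \<le> s_k follows 2x \<le> s_(k-1), two levels above s_(k+1) < x; hence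
    1/4. For \<open>k = 0\<close> the truncated k - 1 is again \<open>0\<close>, and the bound is
    the domain condition.\<close>
  have "assoc_fun (2 * x) \<le> 1 / 2 ^ (k - 1)"
  proof (rule assoc_fun_upper)
    show "2 * x \<le> mean_length a (k - 1)"
      using x k(2) mean_length_Suc[of "k - 1"] by (cases k) auto
  qed (use x in auto)
  also have "\<dots> \<le> 4 * (1 / 2 ^ Suc k)"
    by (cases k) auto
  also have "\<dots> \<le> 4 * assoc_fun x"
    using assoc_fun_lower[of "Suc k" x] k(1) x by simp
  finally show "1 / 4 * assoc_fun (2 * x) \<le> assoc_fun x"
    by simp
qed simp

lemma assoc_fun_dimension_function: "(mean_length a 0, assoc_fun) \<in> dimension_functions"
proof -
  have "isCont interpolant 0"
    using continuous_interpolant by (simp add: continuous_on_eq_continuous_within)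
  then have "(interpolant \<longlongrightarrow> 0) (at_right 0)"
    by (simp add: isCont_def filterlim_at_split interpolant_0)
  moreover have "\<forall>\<^sub>F x in at_right 0. assoc_fun x = interpolant x"
    using eventually_at_right_real[OF mean_length_pos[of 0]] by eventually_elim (simp add: assoc_fun_eq)
  ultimately have "(assoc_fun \<longlongrightarrow> 0) (at_right 0)"
    by (simp cong: tendsto_cong)
  then show ?thesis
    using inc_cont_fun_assoc_fun doubling_assoc_fun by (simp add: dimension_functions_def)
qed

text \<open>For n from 2^k up to 2^(k+1) the argument lies between s_(k+1) and s_k, so the value
  lies between 1/2^(k+1) and 1/2^k. Multiplication by \<open>n\<close> gives the constants 1/2 and
  2.\<close>

lemma associated_assoc_fun: "associated a (mean_length a 0, assoc_fun)"
  unfolding associated_def equivalent_seq_on_def prod.case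
proof (rule conjI[OF inc_cont_fun_assoc_fun], rule exI[of _ "1/2"], rule conjI, simp,
    rule exI[of _ 2], rule conjI, simp, intro ballI conjI)
  fix n assume "n \<in> {n. 1 \<le> n \<and> tail a n / real n \<le> mean_length a 0}"
  then have n: "1 \<le> n" "tail a n / real n \<le> mean_length a 0"
    by auto
  obtain k where k: "2 ^ k \<le> n" "n < 2 ^ Suc k"
    using ex_power_ivl1[of 2 n] n(1) by auto
  have "real (2 ^ k) \<le> real n" "real n \<le> real (2 ^ Suc k)"
    unfolding of_nat_le_iff using k by auto
  then have k': "2 ^ k \<le> real n" "real n \<le> 2 ^ Suc k"
    by simp_all
  have "tail a n / real n \<le> mean_length a k"
    using tail_div_antimono[of "2 ^ k" n] k by (simp add: mean_length_def)
  then have upper: "assoc_fun (tail a n / real n) \<le> 1 / 2 ^ k"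
    using n(1) tail_pos by (intro assoc_fun_upper) auto
  have "mean_length a (Suc k) \<le> tail a n / real n"
    using tail_div_antimono[of n "2 ^ Suc k"] k n(1) by (simp add: mean_length_def)
  then have lower: "1 / 2 ^ Suc k \<le> assoc_fun (tail a n / real n)"
    using n(2) by (rule assoc_fun_lower)
  have "1 / 2 = 2 ^ k * (1 / 2 ^ Suc k :: real)"
    by simp
  also have "\<dots> \<le> real n * assoc_fun (tail a n / real n)"
    using lower k' by (intro mult_mono) auto
  finally show "1 / 2 \<le> assoc_fun (tail a n / real n) / (1 / real n)"
    by (simp add: mult.commute)
  have "real n * assoc_fun (tail a n / real n) \<le> 2 ^ Suc k * (1 / 2 ^ k)"
    using upper lower k' by (intro mult_mono) (auto intro: order_trans[OF _ lower])
  then show "assoc_fun (tail a n / real n) / (1 / real n) \<le> 2"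
    by (simp add: mult.commute)
qed

end

text \<open>Between the averages k + 1 and \<open>k\<close> of \<open>a\<close> the first function
  is at most 1/2^k. There the argument exceeds the average k + 1 + J of \<open>b\<close>, so the
  second is at least 1/2^(k+1+J).\<close>

lemma dominated_assoc_fun:
  assumes a: "gap_sequence a" and b: "gap_sequence b" and dom: "dyadic_dominated b a"
  shows "dominated (mean_length a 0, gap_seq.assoc_fun a) (mean_length b 0, gap_seq.assoc_fun b)"
proof -
  interpret a: gap_seq a
    using a by unfold_locales
  interpret b: gap_seq b
    using b by unfold_locales
  obtain J where J: "\<And>k. mean_length b (k + J) \<le> mean_length a k"
    using dom by (auto simp: dyadic_dominated_def)
  have "a.assoc_fun x \<le> 2 ^ Suc J * b.assoc_fun x"
    if x: "0 < x" "x \<le> mean_length a 0" "x \<le> mean_length b 0" for x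
  proof -
    obtain k where k: "mean_length a (Suc k) < x" "x \<le> mean_length a k"
      using a.mean_length_bracket[of x 0] x by auto
    have "a.assoc_fun x \<le> 1 / 2 ^ k"
      using x(1) k(2) by (rule a.assoc_fun_upper)
    also have "\<dots> = 2 ^ Suc J * (1 / 2 ^ (Suc k + J))"
      by (simp add: power_add)
    also have "\<dots> \<le> 2 ^ Suc J * b.assoc_fun x"
      using J[of "Suc k"] k(1) x(3) by (intro mult_left_mono b.assoc_fun_lower) auto
    finally show ?thesis .
  qed
  then show ?thesis
    unfolding dominated_def prod.case by (intro exI[of _ "2 ^ Suc J"]) auto
qed

text \<open>As the inequality between the two measures is automatic, regularity reduces to
  conditions that the criteria for 0 and infinity decide.\<close>

lemma regular_for_iff:
  "(A, h) \<in> dimension_functions \<Longrightarrow>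
     regular_for h E \<longleftrightarrow> hausdorff_measure h E \<noteq> 0 \<and> packing_measure h E \<noteq> \<infinity>"
  using hausdorff_measure_le_packing_measure[of A h E]
  by (auto simp: regular_for_def less_top zero_less_iff_neq_zero)

text \<open>
  For \<open>h\<close> associated to \<open>a\<close>, the numbers \<open>2 ^ k * h (mean_length a k)\<close> are \<open>1\<close>, and \<open>h\<close>-regularity of
  the Cantor set of \<open>b\<close> keeps \<open>2 ^ k * h (mean_length b k)\<close> between two positive constants.
\<close>

lemma dyadic_dominated_if_regular:
  assumes a: "gap_sequence a" and b: "gap_sequence b"
    and regular: "regular_for (gap_seq.assoc_fun a) (cantor_set t b)"
  shows "dyadic_dominated b a \<and> dyadic_dominated a b"
proof -
  interpret a: gap_seq a
    using a by unfold_locales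
  interpret b: cantor b t
    using b by unfold_locales
  let ?h = "a.assoc_fun"
  note h = a.assoc_fun_dimension_function
  have "hausdorff_measure ?h (cantor_set t b) \<noteq> 0" "packing_measure ?h (cantor_set t b) \<noteq> \<infinity>"
    using regular by (auto simp: regular_for_iff[OF h])
  then obtain c\<^sub>1 c\<^sub>2 where c: "0 < c\<^sub>1"
      "\<forall>\<^sub>F k in sequentially. \<not> 2 ^ k * ?h (mean_length b k) \<le> c\<^sub>1"
      "\<forall>\<^sub>F k in sequentially. \<not> c\<^sub>2 \<le> 2 ^ k * ?h (mean_length b k)"
    unfolding b.hausdorff_measure_cantor_eq_0_iff[OF h] b.packing_measure_cantor_eq_top_iff[OF h]
    by (auto simp: not_frequently)
  have le: "\<forall>\<^sub>F k in sequentially. c\<^sub>1 \<le> 2 ^ k * ?h (mean_length b k)"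
      "\<forall>\<^sub>F k in sequentially. 2 ^ k * ?h (mean_length b k) \<le> c\<^sub>2"
    using c(2,3) by (auto elim: eventually_mono)
  show ?thesis
    using dyadic_dominatedI_mono[OF a b a.inc_cont_fun_assoc_fun, of 1, OF _ _ le(2)]
      dyadic_dominatedI_mono[OF b a a.inc_cont_fun_assoc_fun c(1) le(1), of 1]
    by (simp add: a.assoc_fun_mean_length)
qed

text \<open>Along the averages of \<open>a\<close> the tested sequence is constantly 1, which
  \<open>L = 1/2\<close> and \<open>L = 2\<close> keep away from 0 and infinity.\<close>

lemma regular_for_assoc_fun:
  assumes "gap_sequence a"
  shows "regular_for (gap_seq.assoc_fun a) (cantor_set s a)"
proof -
  interpret cantor a s
    using assms by unfold_locales
  have "\<exists>L>0. \<not> (1::real) \<le> L"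
    by (rule exI[of _ "1/2"]) simp
  moreover have "\<exists>L>0. \<not> L \<le> (1::real)"
    by (rule exI[of _ 2]) simp
  ultimately show ?thesis
    unfolding regular_for_iff[OF assoc_fun_dimension_function]
      hausdorff_measure_cantor_eq_0_iff[OF assoc_fun_dimension_function]
      packing_measure_cantor_eq_top_iff[OF assoc_fun_dimension_function]
    by (simp add: assoc_fun_mean_length)
qed

theorem theorem4p4:
  fixes a b :: "nat \<Rightarrow> real" and s t :: real
  assumes "gap_sequence a" and "gap_sequence b"
  shows "all_equivalent
    [\<exists>h\<^sub>a h\<^sub>b. associated a h\<^sub>a \<and> associated b h\<^sub>b \<and> equivalent_fun h\<^sub>a h\<^sub>b,
     {(A, h) \<in> dimension_functions. regular_for h (cantor_set s a)} =
       {(A, h) \<in> dimension_functions. regular_for h (cantor_set t b)},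
     \<forall>\<alpha>\<in>{0, 1, \<infinity>}. \<forall>\<beta>\<in>{0, 1, \<infinity>}. \<alpha> \<le> \<beta> \<longrightarrow>
       hausdorff_class \<alpha> (cantor_set s a) \<inter> packing_class \<beta> (cantor_set s a) =
       hausdorff_class \<alpha> (cantor_set t b) \<inter> packing_class \<beta> (cantor_set t b),
     weak_tail_equivalent a b]"
    (is "all_equivalent [?assoc, ?regular, ?partition, ?weak]")
proof -
  note ab = assms and ba = assms(2,1)
  interpret a: gap_seq a
    using assms(1) by unfold_locales
  interpret b: gap_seq b
    using assms(2) by unfold_locales
  define dom where "dom \<longleftrightarrow> dyadic_dominated b a \<and> dyadic_dominated a b"
  have weak: "?weak \<longleftrightarrow> dom"
    unfolding weak_tail_equivalent_def dom_def dyadic_dominated_iff_tail[OF ab] dyadic_dominated_iff_tail[OF ba]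
    by blast
  have assoc: "?assoc \<longleftrightarrow> dom"
  proof
    assume ?assoc
    then show dom
      using dyadic_dominated_if_associated[OF ab] dyadic_dominated_if_associated[OF ba]
      unfolding equivalent_fun_def dom_def by blast
  next
    assume dom
    then have "equivalent_fun (mean_length a 0, a.assoc_fun) (mean_length b 0, b.assoc_fun)"
      using dominated_assoc_fun[OF ab] dominated_assoc_fun[OF ba]
      by (simp add: equivalent_fun_def dom_def)
    then show ?assoc
      using a.associated_assoc_fun b.associated_assoc_fun by blast
  qed
  have measures: "hausdorff_measure h (cantor_set s a) = 0 \<longleftrightarrow> hausdorff_measure h (cantor_set t b) = 0"
      "hausdorff_measure h (cantor_set s a) = \<infinity> \<longleftrightarrow> hausdorff_measure h (cantor_set t b) = \<infinity>"
      "packing_measure h (cantor_set s a) = 0 \<longleftrightarrow> packing_measure h (cantor_set t b) = 0"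
      "packing_measure h (cantor_set s a) = \<infinity> \<longleftrightarrow> packing_measure h (cantor_set t b) = \<infinity>"
    if dom and h: "(A, h) \<in> dimension_functions" for A h
  proof -
    have "dyadic_dominated b a" "dyadic_dominated a b"
      using \<open>dom\<close> by (auto simp: dom_def)
    note 1 = measures_if_dyadic_dominated[OF ab this(1) h, where s = s and t = t]
      and 2 = measures_if_dyadic_dominated[OF ba this(2) h, where s = t and t = s]
    show "hausdorff_measure h (cantor_set s a) = 0 \<longleftrightarrow> hausdorff_measure h (cantor_set t b) = 0"
      by (rule iffI, erule 1(1), erule 2(1))
    show "hausdorff_measure h (cantor_set s a) = \<infinity> \<longleftrightarrow> hausdorff_measure h (cantor_set t b) = \<infinity>"
      by (rule iffI, erule 2(2), erule 1(2))
    show "packing_measure h (cantor_set s a) = 0 \<longleftrightarrow> packing_measure h (cantor_set t b) = 0"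
      by (rule iffI, erule 1(3), erule 2(3))
    show "packing_measure h (cantor_set s a) = \<infinity> \<longleftrightarrow> packing_measure h (cantor_set t b) = \<infinity>"
      by (rule iffI, erule 2(4), erule 1(4))
  qed
  have regular_iff: "?regular \<longleftrightarrow> dom"
  proof
    assume ?regular
    \<comment> \<open>The function built from \<open>a\<close> is regular for its own Cantor set, so
      equality of the two families makes it a test function on the other one.\<close>
    moreover have "(mean_length a 0, a.assoc_fun) \<in> {(A, h) \<in> dimension_functions. regular_for h (cantor_set s a)}"
      using a.assoc_fun_dimension_function regular_for_assoc_fun[OF assms(1)] by simp
    ultimately have "regular_for a.assoc_fun (cantor_set t b)"
      by blast
    then show dom
      unfolding dom_def by (rule dyadic_dominated_if_regular[OF ab])
  next
    assume dom
    then show ?regular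
      using measures by (auto simp: regular_for_iff)
  qed
  have partition_iff: "?partition \<longleftrightarrow> dom"
  proof
    assume ?partition
    \<comment> \<open>The cell with both indices \<open>1\<close> consists of the functions for
      which the set is regular, so the same test function applies.\<close>
    then have "hausdorff_class 1 (cantor_set s a) \<inter> packing_class 1 (cantor_set s a) =
       hausdorff_class 1 (cantor_set t b) \<inter> packing_class 1 (cantor_set t b)"
      by simp
    moreover have "(mean_length a 0, a.assoc_fun) \<in>
        hausdorff_class 1 (cantor_set s a) \<inter> packing_class 1 (cantor_set s a)"
      using a.assoc_fun_dimension_function regular_for_assoc_fun[OF assms(1), of s]
      by (auto simp: hausdorff_class_def packing_class_def regular_for_def)
    ultimately have "(mean_length a 0, a.assoc_fun) \<in>
        hausdorff_class 1 (cantor_set t b) \<inter> packing_class 1 (cantor_set t b)"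
      by blast
    then have "regular_for a.assoc_fun (cantor_set t b)"
      by (auto simp: hausdorff_class_def packing_class_def regular_for_iff[OF a.assoc_fun_dimension_function])
    then show dom
      unfolding dom_def by (rule dyadic_dominated_if_regular[OF ab])
  next
    assume dom
    \<comment> \<open>Class \<open>1\<close> is what the values 0 and infinity leave over, so
      agreement at these two settles all three classes.\<close>
    have class_cong: "(if \<alpha> = 1 then 0 < x \<and> x < \<infinity> else x = \<alpha>) \<longleftrightarrow> (if \<alpha> = 1 then 0 < y \<and> y < \<infinity> else y = \<alpha>)"
      if "\<alpha> \<in> {0, 1, \<infinity>}" "x = 0 \<longleftrightarrow> y = 0" "x = \<infinity> \<longleftrightarrow> y = \<infinity>" for \<alpha> x y :: ennreal
      using that by (auto simp: zero_less_iff_neq_zero less_top[symmetric])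
    have "hausdorff_class \<alpha> (cantor_set s a) = hausdorff_class \<alpha> (cantor_set t b)"
        "packing_class \<alpha> (cantor_set s a) = packing_class \<alpha> (cantor_set t b)"
      if \<alpha>: "\<alpha> \<in> {0, 1, \<infinity>}" for \<alpha>
      using class_cong[OF \<alpha> measures(1,2)[OF \<open>dom\<close>]] class_cong[OF \<alpha> measures(3,4)[OF \<open>dom\<close>]]
      unfolding hausdorff_class_def packing_class_def by blast+
    then show ?partition
      by simp
  qed
  show ?thesis
    unfolding assoc regular_iff partition_iff weak by (simp add: all_equivalent_def)
qed

end
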